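(* Let $S$ be a $\mathrm{Cu}$-semigroup satisfying (O5), (O6), (O7) and (O8), and let $I$ be an ideal in $S$. Then $S$ is $(m,n)$-pure for some $m,n\in\mathbb{N}$ if and only if $I$ is $(m',n')$-pure for some $m',n'\in\mathbb{N}$ and $S/I$ is $(m'',n'')$-pure for some $m'',n''\in\mathbb{N}$.
   Context: A $\mathrm{Cu}$-semigroup is a positively ordered (commutative) monoid $S$ (partial order compatible with addition, $0\leq x$ for all $x$) such that: (O1) increasing sequences have suprema; (O2) every element is the supremum of a sequence $(x_n)_n$ with $x_n\ll x_{n+1}$; (O3) $x'\ll x$ and $y'\ll y$ imply $x'+y'\ll x+y$; (O4) $\sup_n(x_n+y_n)=\sup_n x_n+\sup_n y_n$ for increasing sequences. Here $x\ll y$ means: for every increasing sequence $(y_n)_n$ with $y\leq\sup_n y_n$ there is $n$ with $x\leq y_n$. Additional axioms: (O5) for all $r',r,s',s,t\in S$ with $r+s\leq t$, $r'\ll r$, $s'\ll s$ there is $u\in S$ with $r'+u\leq t\leq r+u$ and $s'\ll u$. (O6) for all $x',x,y,z$ with $x'\ll x\leq y+z$ there are $e,f$ with $x'\leq e+f$, $e\leq x,y$ and $f\leq x,z$. (O7) for all $x_1',x_1,x_2',x_2,w$ with $x_1'\ll x_1\leq w$ and $x_2'\ll x_2\leq w$ there is $x$ with $x_1',x_2'\ll x$ and $x\leq w$, $x\leq x_1+x_2$. (O8) for all $x',x,y',y,z,w$ with $x+y\ll z+w$, $x'\ll x$, $y'\ll y$ and $2w=w$ there are $z_1,z_2$ with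 $z_1+z_2\ll z$, $x'\ll z_1+w$, $y'\ll z_2+w$, $z_1\ll x+w$, $z_2\ll y+w$. An ideal of $S$ is a submonoid $I\subseteq S$ closed under suprema of increasing sequences and downward hereditary ($x\leq y\in I$ implies $x\in I$). Write $x\leq_I y$ if $x\leq y+w$ for some $w\in I$, and $x\sim_I y$ if $x\leq_I y$ and $y\leq_I x$; $S/I$ is the set of $\sim_I$-classes with the induced addition and order, which is a $\mathrm{Cu}$-semigroup. An ideal is a $\mathrm{Cu}$-semigroup with the induced structure. Write $x<_s y$ if $(n+1)x\leq ny$ for some $n\in\mathbb{N}$ ($\mathbb{N}$ includes $0$). $S$ has $m$-comparison if whenever $x,y_0,\ldots,y_m\in S$ satisfy $x<_s y_j$ for $j=0,\ldots,m$, then $x\leq y_0+\ldots+y_m$. $S$ is $n$-almost divisible if for any $k\in\mathbb{N}$ and $x'\ll x$ in $S$ there is $y\in S$ with $ky\leq x$ and $x'\leq(k+1)(n+1)y$. $S$ is $(m,n)$-pure if it has $m$-comparison and is $n$-almost divisible. *)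

theory Defs
  imports "HOL-Algebra.FiniteProduct"
begin

text \<open>
  The addition of a positively ordered monoid is the operation of a HOL-Algebra commutative
  monoid. Hence, in the notation below, \<open>x \<otimes> y\<close> is the sum of \<open>x\<close> and \<open>y\<close>, \<open>\<one>\<close> is
  the neutral element 0, \<open>x [^] k\<close> is the multiple \<open>k x\<close>, and \<open>finprod\<close> is a finite sum.
\<close>

record 'a ordered_monoid = "'a monoid" +
  mle :: "'a \<Rightarrow> 'a \<Rightarrow> bool" (infix "\<preceq>\<index>" 50)

locale positively_ordered_monoid = comm_monoid S for S (structure) +
  assumes mle_refl: "x \<in> carrier S \<Longrightarrow> x \<preceq> x"
    and mle_antisym: "\<lbrakk>x \<in> carrier S; y \<in> carrier S; x \<preceq> y; y \<preceq> x\<rbrakk> \<Longrightarrow> x = y"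
    and mle_trans: "\<lbrakk>x \<in> carrier S; y \<in> carrier S; z \<in> carrier S; x \<preceq> y; y \<preceq> z\<rbrakk> \<Longrightarrow> x \<preceq> z"
    and mle_add: "\<lbrakk>x \<in> carrier S; y \<in> carrier S; z \<in> carrier S; x \<preceq> y\<rbrakk> \<Longrightarrow> x \<otimes> z \<preceq> y \<otimes> z"
    and mle_zero: "x \<in> carrier S \<Longrightarrow> \<one> \<preceq> x"

definition increasing_seq :: "('a, 'b) ordered_monoid_scheme \<Rightarrow> (nat \<Rightarrow> 'a) \<Rightarrow> bool" where
  "increasing_seq S f \<longleftrightarrow> (\<forall>n. f n \<in> carrier S) \<and> (\<forall>n. f n \<preceq>\<^bsub>S\<^esub> f (Suc n))"

definition is_seq_sup :: "('a, 'b) ordered_monoid_scheme \<Rightarrow> (nat \<Rightarrow> 'a) \<Rightarrow> 'a \<Rightarrow> bool" where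
  "is_seq_sup S f s \<longleftrightarrow> s \<in> carrier S \<and> (\<forall>n. f n \<preceq>\<^bsub>S\<^esub> s) \<and>
     (\<forall>t\<in>carrier S. (\<forall>n. f n \<preceq>\<^bsub>S\<^esub> t) \<longrightarrow> s \<preceq>\<^bsub>S\<^esub> t)"

definition way_below :: "('a, 'b) ordered_monoid_scheme \<Rightarrow> 'a \<Rightarrow> 'a \<Rightarrow> bool"
    (infix "\<lless>\<index>" 50) where
  "x \<lless>\<^bsub>S\<^esub> y \<longleftrightarrow>
     (\<forall>f s. increasing_seq S f \<and> is_seq_sup S f s \<and> y \<preceq>\<^bsub>S\<^esub> s \<longrightarrow> (\<exists>n. x \<preceq>\<^bsub>S\<^esub> f n))"

locale cu_semigroup = positively_ordered_monoid +
  assumes O1: "increasing_seq S f \<Longrightarrow> \<exists>s. is_seq_sup S f s"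
    and O2: "x \<in> carrier S \<Longrightarrow>
      \<exists>f. (\<forall>n. f n \<in> carrier S) \<and> (\<forall>n. f n \<lless> f (Suc n)) \<and> is_seq_sup S f x"
    and O3: "\<lbrakk>x' \<in> carrier S; x \<in> carrier S; y' \<in> carrier S; y \<in> carrier S; x' \<lless> x; y' \<lless> y\<rbrakk>
      \<Longrightarrow> x' \<otimes> y' \<lless> x \<otimes> y"
    and O4: "\<lbrakk>increasing_seq S f; increasing_seq S g; is_seq_sup S f x; is_seq_sup S g y\<rbrakk>
      \<Longrightarrow> is_seq_sup S (\<lambda>n. f n \<otimes> g n) (x \<otimes> y)"

definition cu_O5 :: "('a, 'b) ordered_monoid_scheme \<Rightarrow> bool" where
  "cu_O5 S \<longleftrightarrow>
     (\<forall>r'\<in>carrier S. \<forall>r\<in>carrier S. \<forall>s'\<in>carrier S. \<forall>s\<in>carrier S. \<forall>t\<in>carrier S.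
       r \<otimes>\<^bsub>S\<^esub> s \<preceq>\<^bsub>S\<^esub> t \<and> r' \<lless>\<^bsub>S\<^esub> r \<and> s' \<lless>\<^bsub>S\<^esub> s \<longrightarrow>
       (\<exists>u\<in>carrier S. r' \<otimes>\<^bsub>S\<^esub> u \<preceq>\<^bsub>S\<^esub> t \<and> t \<preceq>\<^bsub>S\<^esub> r \<otimes>\<^bsub>S\<^esub> u \<and> s' \<lless>\<^bsub>S\<^esub> u))"

definition cu_O6 :: "('a, 'b) ordered_monoid_scheme \<Rightarrow> bool" where
  "cu_O6 S \<longleftrightarrow>
     (\<forall>x'\<in>carrier S. \<forall>x\<in>carrier S. \<forall>y\<in>carrier S. \<forall>z\<in>carrier S.
       x' \<lless>\<^bsub>S\<^esub> x \<and> x \<preceq>\<^bsub>S\<^esub> y \<otimes>\<^bsub>S\<^esub> z \<longrightarrow>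
       (\<exists>e\<in>carrier S. \<exists>f\<in>carrier S. x' \<preceq>\<^bsub>S\<^esub> e \<otimes>\<^bsub>S\<^esub> f \<and>
          e \<preceq>\<^bsub>S\<^esub> x \<and> e \<preceq>\<^bsub>S\<^esub> y \<and> f \<preceq>\<^bsub>S\<^esub> x \<and> f \<preceq>\<^bsub>S\<^esub> z))"

definition cu_O7 :: "('a, 'b) ordered_monoid_scheme \<Rightarrow> bool" where
  "cu_O7 S \<longleftrightarrow>
     (\<forall>x1'\<in>carrier S. \<forall>x1\<in>carrier S. \<forall>x2'\<in>carrier S. \<forall>x2\<in>carrier S. \<forall>w\<in>carrier S.
       x1' \<lless>\<^bsub>S\<^esub> x1 \<and> x1 \<preceq>\<^bsub>S\<^esub> w \<and> x2' \<lless>\<^bsub>S\<^esub> x2 \<and> x2 \<preceq>\<^bsub>S\<^esub> w \<longrightarrow>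
       (\<exists>x\<in>carrier S. x1' \<lless>\<^bsub>S\<^esub> x \<and> x2' \<lless>\<^bsub>S\<^esub> x \<and> x \<preceq>\<^bsub>S\<^esub> w \<and> x \<preceq>\<^bsub>S\<^esub> x1 \<otimes>\<^bsub>S\<^esub> x2))"

definition cu_O8 :: "('a, 'b) ordered_monoid_scheme \<Rightarrow> bool" where
  "cu_O8 S \<longleftrightarrow>
     (\<forall>x'\<in>carrier S. \<forall>x\<in>carrier S. \<forall>y'\<in>carrier S. \<forall>y\<in>carrier S. \<forall>z\<in>carrier S. \<forall>w\<in>carrier S.
       x \<otimes>\<^bsub>S\<^esub> y \<lless>\<^bsub>S\<^esub> z \<otimes>\<^bsub>S\<^esub> w \<and> x' \<lless>\<^bsub>S\<^esub> x \<and> y' \<lless>\<^bsub>S\<^esub> y \<and> w [^]\<^bsub>S\<^esub> (2::nat) = w \<longrightarrow>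
       (\<exists>z1\<in>carrier S. \<exists>z2\<in>carrier S. z1 \<otimes>\<^bsub>S\<^esub> z2 \<lless>\<^bsub>S\<^esub> z \<and>
          x' \<lless>\<^bsub>S\<^esub> z1 \<otimes>\<^bsub>S\<^esub> w \<and> y' \<lless>\<^bsub>S\<^esub> z2 \<otimes>\<^bsub>S\<^esub> w \<and>
          z1 \<lless>\<^bsub>S\<^esub> x \<otimes>\<^bsub>S\<^esub> w \<and> z2 \<lless>\<^bsub>S\<^esub> y \<otimes>\<^bsub>S\<^esub> w))"

definition cu_ideal :: "'a set \<Rightarrow> ('a, 'b) ordered_monoid_scheme \<Rightarrow> bool" where
  "cu_ideal I S \<longleftrightarrow> submonoid I S \<and>
     (\<forall>f s. increasing_seq S f \<and> (\<forall>n. f n \<in> I) \<and> is_seq_sup S f s \<longrightarrow> s \<in> I) \<and>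
     (\<forall>x\<in>carrier S. \<forall>y\<in>I. x \<preceq>\<^bsub>S\<^esub> y \<longrightarrow> x \<in> I)"

definition cu_sub :: "('a, 'b) ordered_monoid_scheme \<Rightarrow> 'a set \<Rightarrow> ('a, 'b) ordered_monoid_scheme" where
  "cu_sub S I = S\<lparr>carrier := I\<rparr>"

definition le_mod :: "('a, 'b) ordered_monoid_scheme \<Rightarrow> 'a set \<Rightarrow> 'a \<Rightarrow> 'a \<Rightarrow> bool" where
  "le_mod S I x y \<longleftrightarrow> (\<exists>w\<in>I. x \<preceq>\<^bsub>S\<^esub> y \<otimes>\<^bsub>S\<^esub> w)"

definition rel_mod :: "('a, 'b) ordered_monoid_scheme \<Rightarrow> 'a set \<Rightarrow> ('a \<times> 'a) set" where
  "rel_mod S I =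
     {(x, y). x \<in> carrier S \<and> y \<in> carrier S \<and> le_mod S I x y \<and> le_mod S I y x}"

text \<open>
  Addition and order on classes are given through representatives; by \<open>cu_quotient_mult_class\<close> and \<open>cu_quotient_mle_class\<close> below, the
  choice of representatives does not matter.
\<close>

definition cu_quotient ::
    "('a, 'b) ordered_monoid_scheme \<Rightarrow> 'a set \<Rightarrow> 'a set ordered_monoid" where
  "cu_quotient S I =
     \<lparr>carrier = carrier S // rel_mod S I,
      mult = (\<lambda>X Y. \<Union>x\<in>X. \<Union>y\<in>Y. rel_mod S I `` {x \<otimes>\<^bsub>S\<^esub> y}),
      one = rel_mod S I `` {\<one>\<^bsub>S\<^esub>},
      mle = (\<lambda>X Y. \<exists>x\<in>X. \<exists>y\<in>Y. le_mod S I x y)\<rparr>"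

lemma le_mod_trans:
  assumes "positively_ordered_monoid S" "cu_ideal I S"
    and c: "x \<in> carrier S" "y \<in> carrier S" "z \<in> carrier S"
    and "le_mod S I x y" "le_mod S I y z"
  shows "le_mod S I x z"
proof -
  interpret positively_ordered_monoid S by fact
  interpret I: submonoid I S using assms(2) by (simp add: cu_ideal_def)
  obtain v w where v: "v \<in> I" "x \<preceq>\<^bsub>S\<^esub> y \<otimes>\<^bsub>S\<^esub> v" and w: "w \<in> I" "y \<preceq>\<^bsub>S\<^esub> z \<otimes>\<^bsub>S\<^esub> w"
    using assms by (auto simp: le_mod_def)
  have vw: "v \<in> carrier S" "w \<in> carrier S" using v w I.subset by auto
  have "y \<otimes>\<^bsub>S\<^esub> v \<preceq>\<^bsub>S\<^esub> z \<otimes>\<^bsub>S\<^esub> w \<otimes>\<^bsub>S\<^esub> v" using mle_add w vw c by simp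
  then have "x \<preceq>\<^bsub>S\<^esub> z \<otimes>\<^bsub>S\<^esub> (w \<otimes>\<^bsub>S\<^esub> v)"
    using mle_trans[of x "y \<otimes>\<^bsub>S\<^esub> v" "z \<otimes>\<^bsub>S\<^esub> w \<otimes>\<^bsub>S\<^esub> v"] v vw c by (simp add: m_assoc)
  then show ?thesis using v w by (auto simp: le_mod_def)
qed

lemma le_mod_add:
  assumes "positively_ordered_monoid S" "cu_ideal I S"
    and c: "x \<in> carrier S" "x' \<in> carrier S" "y \<in> carrier S" "y' \<in> carrier S"
    and "le_mod S I x x'" "le_mod S I y y'"
  shows "le_mod S I (x \<otimes>\<^bsub>S\<^esub> y) (x' \<otimes>\<^bsub>S\<^esub> y')"
proof -
  interpret positively_ordered_monoid S by fact
  interpret I: submonoid I S using assms(2) by (simp add: cu_ideal_def)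
  obtain v w where v: "v \<in> I" "x \<preceq>\<^bsub>S\<^esub> x' \<otimes>\<^bsub>S\<^esub> v" and w: "w \<in> I" "y \<preceq>\<^bsub>S\<^esub> y' \<otimes>\<^bsub>S\<^esub> w"
    using assms by (auto simp: le_mod_def)
  have vw: "v \<in> carrier S" "w \<in> carrier S" using v w I.subset by auto
  have 1: "x \<otimes>\<^bsub>S\<^esub> y \<preceq>\<^bsub>S\<^esub> (x' \<otimes>\<^bsub>S\<^esub> v) \<otimes>\<^bsub>S\<^esub> y" using mle_add v vw c by simp
  have 2: "y \<otimes>\<^bsub>S\<^esub> (x' \<otimes>\<^bsub>S\<^esub> v) \<preceq>\<^bsub>S\<^esub> (y' \<otimes>\<^bsub>S\<^esub> w) \<otimes>\<^bsub>S\<^esub> (x' \<otimes>\<^bsub>S\<^esub> v)" using mle_add w vw c by simp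
  have "x \<otimes>\<^bsub>S\<^esub> y \<preceq>\<^bsub>S\<^esub> (y' \<otimes>\<^bsub>S\<^esub> w) \<otimes>\<^bsub>S\<^esub> (x' \<otimes>\<^bsub>S\<^esub> v)"
    using mle_trans[OF _ _ _ 1] 2 c vw by (simp add: m_comm)
  also have "\<dots> = (x' \<otimes>\<^bsub>S\<^esub> y') \<otimes>\<^bsub>S\<^esub> (v \<otimes>\<^bsub>S\<^esub> w)" using c vw by (simp add: m_ac)
  finally show ?thesis using v w by (auto simp: le_mod_def)
qed

lemma equiv_rel_mod:
  assumes "positively_ordered_monoid S" "cu_ideal I S"
  shows "equiv (carrier S) (rel_mod S I)"
proof -
  interpret positively_ordered_monoid S by fact
  have "\<one>\<^bsub>S\<^esub> \<in> I" using assms(2) by (simp add: cu_ideal_def submonoid.one_closed)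
  then have "le_mod S I x x" if "x \<in> carrier S" for x
    using that mle_refl unfolding le_mod_def by (metis r_one)
  moreover have "trans (rel_mod S I)"
    unfolding trans_def rel_mod_def using le_mod_trans[OF assms] by blast
  ultimately show ?thesis
    by (intro equivI) (auto simp: rel_mod_def refl_on_def sym_def)
qed

lemma cu_quotient_mult_class:
  assumes "positively_ordered_monoid S" "cu_ideal I S" "x \<in> carrier S" "y \<in> carrier S"
  shows "rel_mod S I `` {x} \<otimes>\<^bsub>cu_quotient S I\<^esub> rel_mod S I `` {y} = rel_mod S I `` {x \<otimes>\<^bsub>S\<^esub> y}"
proof -
  interpret positively_ordered_monoid S by fact
  note eq = equiv_rel_mod[OF assms(1,2)]
  have "rel_mod S I `` {a \<otimes>\<^bsub>S\<^esub> b} = rel_mod S I `` {x \<otimes>\<^bsub>S\<^esub> y}"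
    if "(x, a) \<in> rel_mod S I" "(y, b) \<in> rel_mod S I" for a b
  proof -
    have "x \<in> carrier S" "a \<in> carrier S" "y \<in> carrier S" "b \<in> carrier S"
      and "le_mod S I x a" "le_mod S I a x" "le_mod S I y b" "le_mod S I b y"
      using that unfolding rel_mod_def by blast+
    then have "(a \<otimes>\<^bsub>S\<^esub> b, x \<otimes>\<^bsub>S\<^esub> y) \<in> rel_mod S I"
      using le_mod_add[OF assms(1,2)] by (simp add: rel_mod_def)
    then show ?thesis by (rule equiv_class_eq[OF eq])
  qed
  moreover have "x \<in> rel_mod S I `` {x}" "y \<in> rel_mod S I `` {y}"
    using equiv_class_self[OF eq] assms(3,4) by blast+
  ultimately have "(\<Union>a\<in>rel_mod S I `` {x}. \<Union>b\<in>rel_mod S I `` {y}. rel_mod S I `` {a \<otimes>\<^bsub>S\<^esub> b})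
      = rel_mod S I `` {x \<otimes>\<^bsub>S\<^esub> y}"
    by blast
  then show ?thesis by (simp add: cu_quotient_def)
qed

lemma cu_quotient_mle_class:
  assumes "positively_ordered_monoid S" "cu_ideal I S" "x \<in> carrier S" "y \<in> carrier S"
  shows "rel_mod S I `` {x} \<preceq>\<^bsub>cu_quotient S I\<^esub> rel_mod S I `` {y} \<longleftrightarrow> le_mod S I x y"
proof -
  note eq = equiv_rel_mod[OF assms(1,2)]
  have "le_mod S I x y"
    if "(x, a) \<in> rel_mod S I" "(y, b) \<in> rel_mod S I" "le_mod S I a b" for a b
  proof -
    have c: "a \<in> carrier S" "b \<in> carrier S" "le_mod S I x a" "le_mod S I b y"
      using that unfolding rel_mod_def by blast+
    have "le_mod S I x b"
      using le_mod_trans[OF assms(1,2) assms(3) c(1,2,3)] that(3) .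
    then show ?thesis
      using le_mod_trans[OF assms(1,2) assms(3) c(2) assms(4)] c(4) by blast
  qed
  moreover have "x \<in> rel_mod S I `` {x}" "y \<in> rel_mod S I `` {y}"
    using equiv_class_self[OF eq] assms(3,4) by blast+
  ultimately have "(\<exists>a\<in>rel_mod S I `` {x}. \<exists>b\<in>rel_mod S I `` {y}. le_mod S I a b)
      \<longleftrightarrow> le_mod S I x y"
    by blast
  then show ?thesis by (simp add: cu_quotient_def)
qed

definition stably_below :: "('a, 'b) ordered_monoid_scheme \<Rightarrow> 'a \<Rightarrow> 'a \<Rightarrow> bool" where
  "stably_below S x y \<longleftrightarrow> (\<exists>n::nat. x [^]\<^bsub>S\<^esub> (n + 1) \<preceq>\<^bsub>S\<^esub> y [^]\<^bsub>S\<^esub> n)"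

definition m_comparison :: "nat \<Rightarrow> ('a, 'b) ordered_monoid_scheme \<Rightarrow> bool" where
  "m_comparison m S \<longleftrightarrow>
     (\<forall>x\<in>carrier S. \<forall>y\<in>{0..m} \<rightarrow> carrier S.
       (\<forall>j\<in>{0..m}. stably_below S x (y j)) \<longrightarrow> x \<preceq>\<^bsub>S\<^esub> finprod S y {0..m})"

definition almost_divisible :: "nat \<Rightarrow> ('a, 'b) ordered_monoid_scheme \<Rightarrow> bool" where
  "almost_divisible n S \<longleftrightarrow>
     (\<forall>k::nat. \<forall>x'\<in>carrier S. \<forall>x\<in>carrier S. x' \<lless>\<^bsub>S\<^esub> x \<longrightarrow>
       (\<exists>y\<in>carrier S. y [^]\<^bsub>S\<^esub> k \<preceq>\<^bsub>S\<^esub> x \<and> x' \<preceq>\<^bsub>S\<^esub> y [^]\<^bsub>S\<^esub> ((k + 1) * (n + 1))))"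

definition pure :: "nat \<Rightarrow> nat \<Rightarrow> ('a, 'b) ordered_monoid_scheme \<Rightarrow> bool" where
  "pure m n S \<longleftrightarrow> m_comparison m S \<and> almost_divisible n S"

end

theory Submission
  imports Defs
begin

text \<open>
  Pureness passes to an ideal \<open>I\<close> because \<open>I\<close> is hereditary and closed under suprema: the relation
  \<open>\<lless>\<close> is the same in both semigroups, and \<open>k y \<le> x \<in> I\<close> with \<open>k \<ge> 1\<close> forces \<open>y \<in> I\<close>.
  It passes to \<open>S/I\<close> because finitely or countably many inequalities modulo \<open>I\<close> become inequalities in \<open>S\<close>
  once a single \<open>w \<in> I\<close> with \<open>2 w = w\<close> is added to their right-hand sides
  (\<open>ideal_absorbing_bound\<close>). The constants do not change.

  Conversely, an inequality in \<open>S/I\<close> gives an inequality \<open>x \<le> y + w\<close> in \<open>S\<close> with \<open>w \<in> I\<close>,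
  and (O6) replaces \<open>w\<close> by some \<open>f \<in> I\<close> with \<open>f \<le> x\<close>. All statements
  about \<open>f\<close> hold up to \<open>\<lless>\<close>, which is harmless since both properties can be tested on elements
  way below \<open>x\<close>. What is left is to treat \<open>f\<close> by means of \<open>I\<close>. The link between \<open>f\<close> and elements outside \<open>I\<close> is
  \<open>ideal_part_of_multiple\<close>: if \<open>f \<le> n y\<close>, then \<open>f \<le> n z\<close> for some \<open>z \<le> y\<close> in \<open>I\<close>.

  For comparison, part of the \<open>y\<^sub>j\<close> is spent on \<open>S/I\<close>, and the others on \<open>f\<close>, as \<open>x <\<^sub>s y\<^sub>j\<close> yields
  \<open>f <\<^sub>s z\<^sub>j\<close> for some \<open>z\<^sub>j \<le> y\<^sub>j\<close> in \<open>I\<close>.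

  For divisibility by \<open>k\<close>, the difficulty is that a divisor \<open>z\<close> of \<open>x\<close> modulo \<open>I\<close> and a divisor \<open>q\<close> of
  \<open>f\<close> only satisfy \<open>k (z + q) \<le> 2 x\<close> in general. The remedy is to divide by \<open>2 k\<close> in \<open>S/I\<close>: by (O8) the result
  lifts to \<open>z\<close> with \<open>2 k z \<le> x\<close> (\<open>lift_division\<close>). If \<open>z\<^sub>0 \<lless> z\<^sub>1 \<lless> z\<close>, then (O5) yields a complement
  \<open>u\<close> with \<open>k z\<^sub>0 + u \<le> x \<le> k z\<^sub>1 + u\<close>, which in addition dominates the unused copy of
  \<open>k z\<^sub>1\<close>. Thus \<open>f \<le> x \<le> 2 u\<close>, so \<open>f \<le> 2 f\<^sub>0\<close> for some \<open>f\<^sub>0 \<le> u\<close> in \<open>I\<close>, and if \<open>q\<close>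
  divides \<open>f\<^sub>0\<close> then \<open>k (z\<^sub>0 + q) \<le> k z\<^sub>0 + u \<le> x\<close>.
\<close>

section \<open>Ordered monoids\<close>

context positively_ordered_monoid
begin

lemma mle_add_mono:
  assumes "x \<in> carrier S" "x' \<in> carrier S" "y \<in> carrier S" "y' \<in> carrier S"
    and "x \<preceq> x'" "y \<preceq> y'"
  shows "x \<otimes> y \<preceq> x' \<otimes> y'"
proof -
  have 1: "x \<otimes> y \<preceq> x' \<otimes> y" using mle_add assms by simp
  have 2: "x' \<otimes> y \<preceq> x' \<otimes> y'" using mle_add[of y y' x'] assms by (simp add: m_comm)
  show ?thesis using mle_trans[OF _ _ _ 1 2] assms by simp
qed

lemma mle_add_left: "\<lbrakk>x \<in> carrier S; y \<in> carrier S\<rbrakk> \<Longrightarrow> x \<preceq> x \<otimes> y"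
  using mle_add_mono[of x x \<one> y] mle_zero mle_refl by simp

lemma mle_add_right: "\<lbrakk>x \<in> carrier S; y \<in> carrier S\<rbrakk> \<Longrightarrow> y \<preceq> x \<otimes> y"
  using mle_add_left[of y x] by (simp add: m_comm)

lemma multiple_one: "x \<in> carrier S \<Longrightarrow> x [^] (1::nat) = x"
  by simp

lemma multiple_mono:
  assumes "x \<in> carrier S" "y \<in> carrier S" "x \<preceq> y"
  shows "x [^] (k::nat) \<preceq> y [^] k"
  by (induction k) (use assms in \<open>simp_all add: mle_add_mono mle_refl\<close>)

lemma multiple_le_multiple:
  assumes "x \<in> carrier S" "(k::nat) \<le> l"
  shows "x [^] k \<preceq> x [^] l"
proof -
  have "x [^] l = x [^] k \<otimes> x [^] (l - k)" using assms by (simp add: nat_pow_mult)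
  then show ?thesis using mle_add_left assms by simp
qed

lemma idempotent_multiple:
  assumes "w \<in> carrier S" "w \<otimes> w = w"
  shows "w [^] Suc k = w"
  by (induction k) (use assms in simp_all)

lemma multiple_le_idempotent:
  assumes "w \<in> carrier S" "w \<otimes> w = w"
  shows "w [^] (k::nat) \<preceq> w"
  using multiple_le_multiple[of w k "Suc k"] idempotent_multiple[OF assms] assms(1) by simp

lemma finprod_mono:
  assumes "finite A" "f \<in> A \<rightarrow> carrier S" "g \<in> A \<rightarrow> carrier S" "\<And>a. a \<in> A \<Longrightarrow> f a \<preceq> g a"
  shows "finprod S f A \<preceq> finprod S g A"
  using assms by (induction A) (simp_all add: mle_refl mle_add_mono Pi_def)

end

lemma m_comparisonD:
  assumes "m_comparison m S" "x \<in> carrier S" "\<And>j. j \<in> {0..m} \<Longrightarrow> y j \<in> carrier S"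
    and "\<And>j. j \<in> {0..m} \<Longrightarrow> stably_below S x (y j)"
  shows "x \<preceq>\<^bsub>S\<^esub> finprod S y {0..m}"
proof -
  have "y \<in> {0..m} \<rightarrow> carrier S" using assms(3) by blast
  then show ?thesis using assms(1,2,4) unfolding m_comparison_def by blast
qed

section \<open>The way-below relation\<close>

context cu_semigroup
begin

lemma increasing_seq_const: "x \<in> carrier S \<Longrightarrow> increasing_seq S (\<lambda>_. x)"
  by (simp add: increasing_seq_def mle_refl)

lemma is_seq_sup_const: "x \<in> carrier S \<Longrightarrow> is_seq_sup S (\<lambda>_. x) x"
  by (simp add: is_seq_sup_def mle_refl)

lemma increasing_seq_add:
  "\<lbrakk>increasing_seq S f; increasing_seq S g\<rbrakk> \<Longrightarrow> increasing_seq S (\<lambda>n. f n \<otimes> g n)"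
  by (simp add: increasing_seq_def mle_add_mono)

lemma increasing_seq_multiple:
  "increasing_seq S f \<Longrightarrow> increasing_seq S (\<lambda>n. f n [^] (k::nat))"
  by (simp add: increasing_seq_def multiple_mono)

lemma is_seq_sup_multiple:
  assumes "increasing_seq S f" "is_seq_sup S f x"
  shows "is_seq_sup S (\<lambda>n. f n [^] (k::nat)) (x [^] k)"
proof (induction k)
  case 0
  then show ?case by (simp add: is_seq_sup_const)
next
  case (Suc k)
  then show ?case
    using O4[OF increasing_seq_multiple[OF assms(1)] assms(1) Suc assms(2)] by simp
qed

lemma way_below_imp_le:
  assumes "y \<in> carrier S" "x \<lless> y"
  shows "x \<preceq> y"
  using assms increasing_seq_const is_seq_sup_const mle_refl unfolding way_below_def by blast

lemma way_below_mono:
  assumes "x \<in> carrier S" "y \<in> carrier S" "z \<in> carrier S" "t \<in> carrier S"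
    and "x \<preceq> y" "y \<lless> z" "z \<preceq> t"
  shows "x \<lless> t"
  unfolding way_below_def
proof (intro allI impI)
  fix f s
  assume fs: "increasing_seq S f \<and> is_seq_sup S f s \<and> t \<preceq> s"
  then have "z \<preceq> s" using mle_trans assms by (meson is_seq_sup_def)
  then obtain n where "y \<preceq> f n" using fs assms(6) unfolding way_below_def by blast
  then show "\<exists>n. x \<preceq> f n" using mle_trans assms fs by (meson increasing_seq_def)
qed

lemma way_below_seq:
  assumes "x \<in> carrier S"
  shows "\<exists>f. increasing_seq S f \<and> is_seq_sup S f x \<and> (\<forall>n. f n \<lless> f (Suc n)) \<and> (\<forall>n. f n \<lless> x)"
proof -
  obtain f where f: "\<forall>n. f n \<in> carrier S" "\<forall>n. f n \<lless> f (Suc n)" "is_seq_sup S f x"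
    using O2[OF assms] by blast
  have "increasing_seq S f" using f way_below_imp_le by (simp add: increasing_seq_def)
  moreover have "f n \<lless> x" for n
    using way_below_mono[of "f n" "f n" "f (Suc n)" x] f mle_refl assms
    by (simp add: is_seq_sup_def)
  ultimately show ?thesis using f by blast
qed

lemma way_below_interpolate:
  assumes "x \<in> carrier S" "z \<in> carrier S" "x \<lless> z"
  obtains y where "y \<in> carrier S" "x \<lless> y" "y \<lless> z"
proof -
  obtain f where f: "increasing_seq S f" "is_seq_sup S f z" "\<And>n. f n \<lless> f (Suc n)" "\<And>n. f n \<lless> z"
    using way_below_seq[OF assms(2)] by blast
  then obtain n where n: "x \<preceq> f n"
    using assms(2,3) mle_refl unfolding way_below_def by blast
  have "x \<lless> f (Suc n)"
    using way_below_mono[of x "f n" "f (Suc n)" "f (Suc n)"] n f(1,3) assms mle_refl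
    by (simp add: increasing_seq_def)
  then show ?thesis using that[of "f (Suc n)"] f by (simp add: increasing_seq_def)
qed

lemma le_if_way_below_le:
  assumes "x \<in> carrier S" "t \<in> carrier S"
    and "\<And>x'. \<lbrakk>x' \<in> carrier S; x' \<lless> x\<rbrakk> \<Longrightarrow> x' \<preceq> t"
  shows "x \<preceq> t"
proof -
  obtain f where "increasing_seq S f" "is_seq_sup S f x" "\<And>n. f n \<lless> x"
    using way_below_seq[OF assms(1)] by blast
  then show ?thesis using assms unfolding is_seq_sup_def increasing_seq_def by blast
qed

lemma way_below_multiple:
  assumes "x' \<in> carrier S" "x \<in> carrier S" "x' \<lless> x"
  shows "x' [^] (k::nat) \<lless> x [^] k"
proof (induction k)
  case 0
  then show ?case
    by (auto simp: way_below_def is_seq_sup_def increasing_seq_def intro: mle_zero)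
next
  case (Suc k)
  then show ?case using O3[OF _ _ _ _ Suc assms(3)] assms by simp
qed

text \<open>
  The map \<open>b \<mapsto> a + k b\<close> preserves suprema of increasing sequences by (O4), so a bound
  \<open>x \<le> a + k b\<close> survives an approximation of \<open>b\<close> from below at the price of an
  approximation of \<open>x\<close>. This supplies the approximations from below that (O5), (O6) and (O7)
  consume.
\<close>

lemma way_below_shrink:
  assumes c: "x' \<in> carrier S" "x \<in> carrier S" "a \<in> carrier S" "b \<in> carrier S"
    and "x' \<lless> x" "x \<preceq> a \<otimes> b [^] (k::nat)"
  obtains b' where "b' \<in> carrier S" "b' \<lless> b" "x' \<preceq> a \<otimes> b' [^] k"
proof -
  obtain f where f: "increasing_seq S f" "is_seq_sup S f b" "\<And>n. f n \<lless> b"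
    using way_below_seq[OF c(4)] by blast
  have "is_seq_sup S (\<lambda>n. a \<otimes> f n [^] k) (a \<otimes> b [^] k)"
    using O4 increasing_seq_const[OF c(3)] increasing_seq_multiple[OF f(1)]
      is_seq_sup_const[OF c(3)] is_seq_sup_multiple[OF f(1,2)] by blast
  moreover have "increasing_seq S (\<lambda>n. a \<otimes> f n [^] k)"
    using increasing_seq_add increasing_seq_const[OF c(3)] increasing_seq_multiple[OF f(1)] by blast
  ultimately obtain n where "x' \<preceq> a \<otimes> f n [^] k"
    using assms(5,6) unfolding way_below_def by blast
  then show ?thesis using that[of "f n"] f by (simp add: increasing_seq_def)
qed

lemma way_below_shrink1:
  assumes "x' \<in> carrier S" "x \<in> carrier S" "a \<in> carrier S" "b \<in> carrier S"
    and "x' \<lless> x" "x \<preceq> a \<otimes> b"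
  obtains b' where "b' \<in> carrier S" "b' \<lless> b" "x' \<preceq> a \<otimes> b'"
proof -
  obtain b' where "b' \<in> carrier S" "b' \<lless> b" "x' \<preceq> a \<otimes> b' [^] Suc 0"
    using way_below_shrink[of x' x a b "Suc 0"] assms by auto
  then show ?thesis using that by simp
qed

end

section \<open>Ideals and quotients\<close>

locale cu_semigroup_ideal = cu_semigroup +
  fixes I :: "'a set"
  assumes ideal: "cu_ideal I S"
begin

lemma ideal_submonoid: "submonoid I S"
  using ideal by (simp add: cu_ideal_def)

lemma ideal_subset: "x \<in> I \<Longrightarrow> x \<in> carrier S"
  using submonoid.subset[OF ideal_submonoid] by (rule subsetD)

lemma ideal_zero: "\<one> \<in> I"
  using submonoid.one_closed[OF ideal_submonoid] .

lemma ideal_add: "\<lbrakk>x \<in> I; y \<in> I\<rbrakk> \<Longrightarrow> x \<otimes> y \<in> I"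
  using submonoid.m_closed[OF ideal_submonoid] .

lemma ideal_sup: "\<lbrakk>increasing_seq S f; \<And>n. f n \<in> I; is_seq_sup S f s\<rbrakk> \<Longrightarrow> s \<in> I"
  using ideal unfolding cu_ideal_def by blast

lemma ideal_hereditary: "\<lbrakk>x \<in> carrier S; y \<in> I; x \<preceq> y\<rbrakk> \<Longrightarrow> x \<in> I"
  using ideal unfolding cu_ideal_def by blast

lemma ideal_multiple: "x \<in> I \<Longrightarrow> x [^] (k::nat) \<in> I"
  by (induction k) (simp_all add: ideal_zero ideal_add)

text \<open>
  The supremum of the sequence \<open>q\<^sub>0 = f\<^sub>0\<close>, \<open>q\<^sub>n\<^sub>+\<^sub>1 = 2 q\<^sub>n + f\<^sub>n\<^sub>+\<^sub>1\<close> absorbs itself because \<open>2 q\<^sub>n \<le> q\<^sub>n\<^sub>+\<^sub>1\<close>. It serves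
  as a single error term for countably many inequalities modulo \<open>I\<close>, and an idempotent one,
  as needed for (O8).
\<close>

lemma ideal_absorbing_bound:
  assumes "\<And>n::nat. f n \<in> I"
  shows "\<exists>w\<in>I. w \<otimes> w = w \<and> (\<forall>n. f n \<preceq> w)"
proof -
  define q where "q = rec_nat (f 0) (\<lambda>n v. v \<otimes> v \<otimes> f (Suc n))"
  have q: "q 0 = f 0" "\<And>n. q (Suc n) = q n \<otimes> q n \<otimes> f (Suc n)" by (simp_all add: q_def)
  have qI: "q n \<in> I" for n by (induction n) (simp_all add: q assms ideal_add)
  note c = ideal_subset[OF qI] ideal_subset[OF assms]
  have dbl: "q n \<otimes> q n \<preceq> q (Suc n)" for n by (simp add: q mle_add_left c)
  have inc: "increasing_seq S q"
    unfolding increasing_seq_def using mle_trans[OF _ _ _ mle_add_left dbl] c by simp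
  obtain w where w: "is_seq_sup S q w" using O1[OF inc] by blast
  then have wc: "w \<in> carrier S" and ub: "\<And>n. q n \<preceq> w" by (simp_all add: is_seq_sup_def)
  have "is_seq_sup S (\<lambda>n. q n \<otimes> q n) (w \<otimes> w)" using O4[OF inc inc w w] .
  moreover have "q n \<otimes> q n \<preceq> w" for n using mle_trans[OF _ _ _ dbl ub] c wc by simp
  ultimately have "w \<otimes> w \<preceq> w" using wc by (simp add: is_seq_sup_def)
  then have "w \<otimes> w = w" using mle_antisym mle_add_left wc by simp
  moreover have "f n \<preceq> q n" for n by (cases n) (simp_all add: q mle_refl mle_add_right c)
  then have "f n \<preceq> w" for n using mle_trans ub c wc by blast
  ultimately show ?thesis using ideal_sup[OF inc qI w] by blast
qed

lemma ideal_absorbing_bound2: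
  assumes "u \<in> I" "v \<in> I"
  obtains w where "w \<in> I" "w \<otimes> w = w" "u \<preceq> w" "v \<preceq> w"
proof -
  have uv: "(if n = 0 then u else v) \<in> I" for n :: nat using assms by simp
  obtain w where w: "w \<in> I" "w \<otimes> w = w" "\<forall>n::nat. (if n = 0 then u else v) \<preceq> w"
    using ideal_absorbing_bound[of "\<lambda>n. if n = 0 then u else v", OF uv] by (elim bexE conjE)
  then show ?thesis using that spec[OF w(3), of 0] spec[OF w(3), of 1] by simp
qed

abbreviation Q :: "'a set ordered_monoid" where "Q \<equiv> cu_quotient S I"
abbreviation cls :: "'a \<Rightarrow> 'a set" where "cls x \<equiv> rel_mod S I `` {x}"

lemma quotient_carrier: "carrier Q = cls ` carrier S"
  by (auto simp: cu_quotient_def quotient_def)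

lemma cls_carrier: "x \<in> carrier S \<Longrightarrow> cls x \<in> carrier Q"
  by (simp add: quotient_carrier)

lemma cls_zero: "\<one>\<^bsub>Q\<^esub> = cls \<one>"
  by (simp add: cu_quotient_def)

lemmas cls_add = cu_quotient_mult_class[OF positively_ordered_monoid_axioms ideal]
lemmas cls_le = cu_quotient_mle_class[OF positively_ordered_monoid_axioms ideal]

lemma comm_monoid_quotient: "comm_monoid Q"
proof (rule comm_monoidI)
  show "\<one>\<^bsub>Q\<^esub> \<in> carrier Q" by (simp add: cls_zero cls_carrier)
next
  fix X Y assume "X \<in> carrier Q" "Y \<in> carrier Q"
  then show "X \<otimes>\<^bsub>Q\<^esub> Y \<in> carrier Q" "X \<otimes>\<^bsub>Q\<^esub> Y = Y \<otimes>\<^bsub>Q\<^esub> X"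
    by (auto simp: quotient_carrier cls_add m_comm)
next
  fix X Y Z assume "X \<in> carrier Q" "Y \<in> carrier Q" "Z \<in> carrier Q"
  then show "X \<otimes>\<^bsub>Q\<^esub> Y \<otimes>\<^bsub>Q\<^esub> Z = X \<otimes>\<^bsub>Q\<^esub> (Y \<otimes>\<^bsub>Q\<^esub> Z)"
    by (auto simp: quotient_carrier cls_add m_assoc)
next
  fix X assume "X \<in> carrier Q"
  then show "\<one>\<^bsub>Q\<^esub> \<otimes>\<^bsub>Q\<^esub> X = X" by (auto simp: quotient_carrier cls_add cls_zero)
qed

lemma cls_multiple: "x \<in> carrier S \<Longrightarrow> cls x [^]\<^bsub>Q\<^esub> (k::nat) = cls (x [^] k)"
proof -
  assume x: "x \<in> carrier S"
  interpret Q: comm_monoid Q by (rule comm_monoid_quotient)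
  show ?thesis by (induction k) (use x in \<open>simp_all add: cls_zero cls_add\<close>)
qed

lemma cls_finprod:
  assumes "finite A" "f \<in> A \<rightarrow> carrier S"
  shows "finprod Q (\<lambda>a. cls (f a)) A = cls (finprod S f A)"
proof -
  interpret Q: comm_monoid Q by (rule comm_monoid_quotient)
  show ?thesis
    using assms by (induction A) (simp_all add: cls_zero cls_add cls_carrier Pi_def)
qed

lemma cls_le_if_le: "\<lbrakk>x \<in> carrier S; y \<in> carrier S; x \<preceq> y\<rbrakk> \<Longrightarrow> cls x \<preceq>\<^bsub>Q\<^esub> cls y"
  using ideal_zero by (auto simp: cls_le le_mod_def intro!: bexI[of _ \<one>])

lemma cls_leE:
  assumes "x \<in> carrier S" "y \<in> carrier S" "cls x \<preceq>\<^bsub>Q\<^esub> cls y"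
  obtains w where "w \<in> I" "x \<preceq> y \<otimes> w"
  using assms by (auto simp: cls_le le_mod_def)

lemma cls_add_ideal:
  assumes "x \<in> carrier S" "w \<in> I"
  shows "cls (x \<otimes> w) = cls x"
proof -
  note c = assms(1) ideal_subset[OF assms(2)]
  have "le_mod S I (x \<otimes> w) x"
    unfolding le_mod_def using assms(2) mle_refl[of "x \<otimes> w"] c by auto
  moreover have "le_mod S I x (x \<otimes> w)"
    unfolding le_mod_def using ideal_zero mle_add_left[OF c] c by (intro bexI[of _ \<one>]) simp_all
  ultimately have "(x \<otimes> w, x) \<in> rel_mod S I" using c unfolding rel_mod_def by simp
  then show ?thesis
    by (rule equiv_class_eq[OF equiv_rel_mod[OF positively_ordered_monoid_axioms ideal]])
qed

lemma quotient_le_trans: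
  assumes "X \<in> carrier Q" "Y \<in> carrier Q" "Z \<in> carrier Q" "X \<preceq>\<^bsub>Q\<^esub> Y" "Y \<preceq>\<^bsub>Q\<^esub> Z"
  shows "X \<preceq>\<^bsub>Q\<^esub> Z"
proof -
  obtain x y z where "x \<in> carrier S" "y \<in> carrier S" "z \<in> carrier S"
    and "X = cls x" "Y = cls y" "Z = cls z"
    using assms(1-3) unfolding quotient_carrier by blast
  then show ?thesis
    using assms(4,5) le_mod_trans[OF positively_ordered_monoid_axioms ideal, of x y z]
    by (simp add: cls_le)
qed

lemma cls_seq_sup:
  assumes "increasing_seq S f" "is_seq_sup S f x"
  shows "is_seq_sup Q (\<lambda>n. cls (f n)) (cls x)"
proof -
  have c: "\<And>n. f n \<in> carrier S" "x \<in> carrier S"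
    using assms by (simp_all add: increasing_seq_def is_seq_sup_def)
  have "cls x \<preceq>\<^bsub>Q\<^esub> cls t" if t: "t \<in> carrier S" and le: "\<And>n. cls (f n) \<preceq>\<^bsub>Q\<^esub> cls t" for t
  proof -
    have "\<exists>v\<in>I. f n \<preceq> t \<otimes> v" for n using le[of n] c t by (auto simp: cls_le le_mod_def)
    then obtain v where v: "\<And>n. v n \<in> I" "\<And>n. f n \<preceq> t \<otimes> v n" by metis
    obtain w where w: "w \<in> I" "w \<otimes> w = w" "\<And>n. v n \<preceq> w"
      using ideal_absorbing_bound[of v, OF v(1)] by blast
    have "f n \<preceq> t \<otimes> w" for n
      using mle_trans[OF _ _ _ v(2) mle_add_mono[OF _ _ _ _ mle_refl w(3)]] c t
        ideal_subset v(1) w(1) by simp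
    then have "x \<preceq> t \<otimes> w" using assms(2) t ideal_subset[OF w(1)] by (simp add: is_seq_sup_def)
    then show ?thesis using w(1) c t by (auto simp: cls_le le_mod_def)
  qed
  moreover have "cls (f n) \<preceq>\<^bsub>Q\<^esub> cls x" for n
    using cls_le_if_le c assms(2) by (simp add: is_seq_sup_def)
  ultimately show ?thesis
    using c by (auto simp: is_seq_sup_def quotient_carrier)
qed

lemma way_below_quotient_lift:
  assumes "a \<in> carrier S" "X \<lless>\<^bsub>Q\<^esub> cls a"
  obtains a' where "a' \<in> carrier S" "a' \<lless> a" "X \<preceq>\<^bsub>Q\<^esub> cls a'"
proof -
  obtain f where f: "increasing_seq S f" "is_seq_sup S f a" "\<And>n. f n \<lless> a"
    using way_below_seq[OF assms(1)] by blast
  have "increasing_seq Q (\<lambda>n. cls (f n))"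
    using f(1) by (simp add: increasing_seq_def cls_carrier cls_le_if_le)
  moreover have "cls a \<preceq>\<^bsub>Q\<^esub> cls a" using assms(1) by (simp add: cls_le_if_le mle_refl)
  ultimately obtain n where "X \<preceq>\<^bsub>Q\<^esub> cls (f n)"
    using assms(2) cls_seq_sup[OF f(1,2)] unfolding way_below_def by blast
  then show ?thesis using that[of "f n"] f by (simp add: increasing_seq_def)
qed

text \<open>
  An increasing sequence of classes lifts to an increasing sequence once one absorbing element
  of \<open>I\<close> is added to all representatives; so a test of \<open>\<lless>\<close> in the quotient becomes a test in
  the semigroup.
\<close>

lemma way_below_quotient:
  assumes c: "x' \<in> carrier S" "x \<in> carrier S" and "x' \<lless> x"
  shows "cls x' \<lless>\<^bsub>Q\<^esub> cls x"
  unfolding way_below_def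
proof (intro allI impI)
  fix F T
  assume "increasing_seq Q F \<and> is_seq_sup Q F T \<and> cls x \<preceq>\<^bsub>Q\<^esub> T"
  then have F: "\<And>n. F n \<in> carrier Q" "\<And>n. F n \<preceq>\<^bsub>Q\<^esub> F (Suc n)"
    and T: "T \<in> carrier Q" "\<And>U. \<lbrakk>U \<in> carrier Q; \<And>n. F n \<preceq>\<^bsub>Q\<^esub> U\<rbrakk> \<Longrightarrow> T \<preceq>\<^bsub>Q\<^esub> U" "cls x \<preceq>\<^bsub>Q\<^esub> T"
    by (simp_all add: increasing_seq_def is_seq_sup_def)
  have "\<exists>g\<in>carrier S. F n = cls g" for n using F(1)[of n] by (auto simp: quotient_carrier)
  then obtain g where g: "\<And>n. g n \<in> carrier S" "\<And>n. F n = cls (g n)" by metis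
  have "\<exists>v\<in>I. g n \<preceq> g (Suc n) \<otimes> v" for n
    using F(2)[of n] g by (simp add: cls_le le_mod_def)
  then obtain v where v: "\<And>n. v n \<in> I" "\<And>n. g n \<preceq> g (Suc n) \<otimes> v n" by metis
  obtain w where w: "w \<in> I" "w \<otimes> w = w" "\<And>n. v n \<preceq> w"
    using ideal_absorbing_bound[of v, OF v(1)] by blast
  have vw: "\<And>n. v n \<in> carrier S" "w \<in> carrier S" using ideal_subset v(1) w(1) by blast+
  have "g n \<otimes> w \<preceq> g (Suc n) \<otimes> w" for n
  proof -
    have "g n \<preceq> g (Suc n) \<otimes> w"
      using mle_trans[OF _ _ _ v(2) mle_add_mono[OF _ _ _ _ mle_refl w(3)]] g vw by simp
    then have "g n \<otimes> w \<preceq> g (Suc n) \<otimes> w \<otimes> w" using mle_add g vw by simp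
    then show ?thesis using g vw w(2) by (simp add: m_assoc)
  qed
  then have inc: "increasing_seq S (\<lambda>n. g n \<otimes> w)" using g vw by (simp add: increasing_seq_def)
  obtain y where y: "is_seq_sup S (\<lambda>n. g n \<otimes> w) y" using O1[OF inc] by blast
  then have yc: "y \<in> carrier S" by (simp add: is_seq_sup_def)
  have "F n \<preceq>\<^bsub>Q\<^esub> cls y" for n
  proof -
    have "g n \<otimes> w \<preceq> y" using y by (simp add: is_seq_sup_def)
    then have "g n \<preceq> y" using mle_trans[OF _ _ _ mle_add_left] g vw yc by blast
    then show ?thesis using g yc by (simp add: cls_le_if_le)
  qed
  then have "cls x \<preceq>\<^bsub>Q\<^esub> cls y"
    using quotient_le_trans[OF _ _ _ T(3) T(2)] T(1) c yc by (simp add: cls_carrier)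
  then obtain u where u: "u \<in> I" "x \<preceq> y \<otimes> u" using cls_leE c yc by blast
  note uc = ideal_subset[OF u(1)]
  have "is_seq_sup S (\<lambda>n. g n \<otimes> w \<otimes> u) (y \<otimes> u)"
    using O4[OF inc increasing_seq_const[OF uc] y is_seq_sup_const[OF uc]] .
  moreover have "increasing_seq S (\<lambda>n. g n \<otimes> w \<otimes> u)"
    using increasing_seq_add[OF inc increasing_seq_const[OF uc]] .
  ultimately obtain n where "x' \<preceq> g n \<otimes> w \<otimes> u"
    using assms(3) u(2) unfolding way_below_def by blast
  then have "x' \<preceq> g n \<otimes> (w \<otimes> u)" using g vw uc by (simp add: m_assoc)
  then have "cls x' \<preceq>\<^bsub>Q\<^esub> F n"
    using ideal_add[OF w(1) u(1)] c g by (auto simp: cls_le le_mod_def)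
  then show "\<exists>n. cls x' \<preceq>\<^bsub>Q\<^esub> F n" by blast
qed

section \<open>The structure of an ideal as a semigroup\<close>

lemma sub_simps [simp]:
  "carrier (cu_sub S I) = I" "mle (cu_sub S I) = mle S" "mult (cu_sub S I) = mult S"
  "one (cu_sub S I) = one S"
  by (simp_all add: cu_sub_def)

lemma sub_multiple: "x [^]\<^bsub>cu_sub S I\<^esub> (k::nat) = x [^] k"
  by (simp add: nat_pow_def)

lemma comm_monoid_sub: "comm_monoid (cu_sub S I)"
  by (rule comm_monoidI) (auto simp: ideal_zero ideal_add ideal_subset m_ac)

lemma sub_finprod:
  assumes "finite A" "f \<in> A \<rightarrow> I"
  shows "finprod (cu_sub S I) f A = finprod S f A"
proof -
  interpret I: comm_monoid "cu_sub S I" by (rule comm_monoid_sub)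
  show ?thesis
    using assms
  proof (induction A)
    case empty
    then show ?case by simp
  next
    case (insert a A)
    then have f: "f \<in> A \<rightarrow> I" "f a \<in> I" by auto
    then have c: "f \<in> A \<rightarrow> carrier S" "f a \<in> carrier S" using ideal_subset by auto
    have "finprod (cu_sub S I) f (insert a A) = f a \<otimes> finprod (cu_sub S I) f A"
      using I.finprod_insert[OF insert(1,2)] f unfolding sub_simps by blast
    also have "\<dots> = finprod S f (insert a A)"
      unfolding insert(3)[OF f(1)] using finprod_insert[OF insert(1,2) c] by (rule sym)
    finally show ?case .
  qed
qed

lemma sub_increasing_seq: "increasing_seq (cu_sub S I) f \<longleftrightarrow> increasing_seq S f \<and> (\<forall>n. f n \<in> I)"
  by (auto simp: increasing_seq_def ideal_subset)

lemma sub_seq_sup: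
  assumes "increasing_seq S f" "\<And>n. f n \<in> I"
  shows "is_seq_sup (cu_sub S I) f s \<longleftrightarrow> is_seq_sup S f s"
proof
  assume s: "is_seq_sup (cu_sub S I) f s"
  obtain t where t: "is_seq_sup S f t" using O1[OF assms(1)] by blast
  have tI: "t \<in> I" using ideal_sup[OF assms t] .
  have "s \<preceq> t" "t \<preceq> s" using s t tI ideal_subset by (auto simp: is_seq_sup_def)
  then have "s = t" using mle_antisym s tI ideal_subset by (simp add: is_seq_sup_def)
  then show "is_seq_sup S f s" using t by simp
next
  assume s: "is_seq_sup S f s"
  then show "is_seq_sup (cu_sub S I) f s"
    using ideal_sup[OF assms s] ideal_subset by (auto simp: is_seq_sup_def)
qed

text \<open>
  The approximating sequence that (O2) provides in the whole semigroup for an element of \<open>I\<close>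
  lies in \<open>I\<close>, so it can be used to test both relations.
\<close>

lemma sub_way_below:
  assumes "x' \<in> I" "x \<in> I"
  shows "x' \<lless>\<^bsub>cu_sub S I\<^esub> x \<longleftrightarrow> x' \<lless> x"
proof
  assume wb: "x' \<lless>\<^bsub>cu_sub S I\<^esub> x"
  obtain f where f: "increasing_seq S f" "is_seq_sup S f x" "\<And>n. f n \<lless> x"
    using way_below_seq[OF ideal_subset[OF assms(2)]] by blast
  then have fI: "f n \<in> I" for n
    using ideal_hereditary[OF _ assms(2)] by (simp add: is_seq_sup_def increasing_seq_def)
  obtain n where "x' \<preceq> f n"
    using wb f(1,2) fI sub_seq_sup[OF f(1) fI] assms mle_refl ideal_subset
    unfolding way_below_def sub_increasing_seq sub_simps by blast
  then show "x' \<lless> x"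
    using way_below_mono[of x' "f n" x x] f(3) fI assms mle_refl ideal_subset by simp
next
  assume "x' \<lless> x"
  then show "x' \<lless>\<^bsub>cu_sub S I\<^esub> x"
    using sub_seq_sup unfolding way_below_def sub_increasing_seq sub_simps by blast
qed

section \<open>Pureness passes to ideals and quotients\<close>

lemma m_comparison_ideal:
  assumes "m_comparison m S"
  shows "m_comparison m (cu_sub S I)"
  unfolding m_comparison_def
proof (intro ballI impI)
  fix x y
  assume x: "x \<in> carrier (cu_sub S I)" and y: "y \<in> {0..m} \<rightarrow> carrier (cu_sub S I)"
    and below: "\<forall>j\<in>{0..m}. stably_below (cu_sub S I) x (y j)"
  have "x \<in> carrier S" "\<And>j. j \<in> {0..m} \<Longrightarrow> y j \<in> carrier S"
    using x y ideal_subset by (auto simp: Pi_iff)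
  then have "x \<preceq> finprod S y {0..m}"
    using m_comparisonD[OF assms, of x y] below
    unfolding stably_below_def sub_multiple sub_simps by blast
  then show "x \<preceq>\<^bsub>cu_sub S I\<^esub> finprod (cu_sub S I) y {0..m}"
    using sub_finprod[of "{0..m}" y] y by simp
qed

lemma almost_divisible_ideal:
  assumes "almost_divisible n S"
  shows "almost_divisible n (cu_sub S I)"
  unfolding almost_divisible_def sub_multiple sub_simps
proof (intro allI ballI impI)
  fix k :: nat and x' x
  assume I: "x' \<in> I" "x \<in> I" and "x' \<lless>\<^bsub>cu_sub S I\<^esub> x"
  then have wb: "x' \<lless> x" by (simp add: sub_way_below)
  note c = I[THEN ideal_subset]
  show "\<exists>y\<in>I. y [^] k \<preceq> x \<and> x' \<preceq> y [^] ((k + 1) * (n + 1))"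
  proof (cases k)
    case 0
    \<comment> \<open>Every \<open>y\<close> has \<open>0 y \<le> x\<close>, so a witness from the whole semigroup need not lie in \<open>I\<close>.\<close>
    have "1 \<le> (k + 1) * (n + 1)" by simp
    then have "x \<preceq> x [^] ((k + 1) * (n + 1))"
      using multiple_le_multiple[OF c(2)] multiple_one[OF c(2)] by metis
    then have "x' \<preceq> x [^] ((k + 1) * (n + 1))"
      using mle_trans[OF c(1,2) nat_pow_closed[OF c(2)] way_below_imp_le[OF c(2) wb]] by blast
    then show ?thesis using 0 I mle_zero c by auto
  next
    case (Suc l)
    obtain y where y: "y \<in> carrier S" "y [^] k \<preceq> x" "x' \<preceq> y [^] ((k + 1) * (n + 1))"
      using assms c wb unfolding almost_divisible_def by blast
    have "y \<preceq> y [^] k" using multiple_le_multiple[of y 1 k] y(1) Suc by simp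
    then have "y \<preceq> x" using mle_trans[OF _ _ _ _ y(2)] y(1) c by simp
    then show ?thesis using ideal_hereditary[OF y(1) I(2)] y by blast
  qed
qed

text \<open>
  The error terms of the given inequalities modulo \<open>I\<close> have a common absorbing bound \<open>w\<close>.
  Adding \<open>w\<close> to every \<open>y\<^sub>j\<close> does not change its class and turns the inequalities into
  inequalities in the semigroup.
\<close>

lemma m_comparison_quotient:
  assumes "m_comparison m S"
  shows "m_comparison m Q"
  unfolding m_comparison_def
proof (intro ballI impI)
  fix X Y
  assume X: "X \<in> carrier Q" and Y: "Y \<in> {0..m} \<rightarrow> carrier Q"
    and below: "\<forall>j\<in>{0..m}. stably_below Q X (Y j)"
  obtain x where x: "x \<in> carrier S" "X = cls x" using X by (auto simp: quotient_carrier)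
  have "\<forall>j\<in>{0..m}. \<exists>y\<in>carrier S. Y j = cls y" using Y by (auto simp: quotient_carrier)
  then obtain y where y: "\<And>j. j \<in> {0..m} \<Longrightarrow> y j \<in> carrier S"
    "\<And>j. j \<in> {0..m} \<Longrightarrow> Y j = cls (y j)" by metis
  have "\<exists>v\<in>I. j \<in> {0..m} \<longrightarrow> (\<exists>n::nat. x [^] (n + 1) \<preceq> y j [^] n \<otimes> v)" for j
  proof (cases "j \<in> {0..m}")
    case True
    then obtain n :: nat where "cls x [^]\<^bsub>Q\<^esub> (n + 1) \<preceq>\<^bsub>Q\<^esub> cls (y j) [^]\<^bsub>Q\<^esub> n"
      using below x(2) y(2) unfolding stably_below_def by metis
    then have "cls (x [^] (n + 1)) \<preceq>\<^bsub>Q\<^esub> cls (y j [^] n)"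
      using cls_multiple[OF x(1), of "n + 1"] cls_multiple[OF y(1)[OF True], of n] by simp
    then show ?thesis using cls_leE[of "x [^] (n + 1)" "y j [^] n"] x y True by force
  next
    case False
    then show ?thesis using ideal_zero by blast
  qed
  then obtain v where v: "\<And>j. v j \<in> I"
    "\<And>j. j \<in> {0..m} \<Longrightarrow> \<exists>n::nat. x [^] (n + 1) \<preceq> y j [^] n \<otimes> v j" by metis
  obtain w where w: "w \<in> I" "w \<otimes> w = w" "\<And>j. v j \<preceq> w"
    using ideal_absorbing_bound[of v, OF v(1)] by blast
  have vw: "\<And>j. v j \<in> carrier S" "w \<in> carrier S" using ideal_subset v(1) w(1) by blast+
  have "stably_below S x (y j \<otimes> w)" if j: "j \<in> {0..m}" for j
  proof -
    obtain n :: nat where n: "x [^] (n + 1) \<preceq> y j [^] n \<otimes> v j" using v(2)[OF j] by blast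
    note c = x(1) y(1)[OF j] vw
    have "x [^] (n + 1) \<preceq> y j [^] n \<otimes> w"
      using mle_trans[OF _ _ _ n mle_add_mono[OF _ _ _ _ mle_refl w(3)]] c by simp
    then show ?thesis
    proof (cases n)
      case 0
      \<comment> \<open>No multiple of \<open>y\<^sub>j + w\<close> is at hand here, but \<open>2 x \<le> w \<le> y\<^sub>j + w\<close>.\<close>
      then have "x \<preceq> w" using \<open>x [^] (n + 1) \<preceq> y j [^] n \<otimes> w\<close> c by simp
      then have "x [^] (2::nat) \<preceq> w [^] (2::nat)" using multiple_mono c by simp
      also have "w [^] (2::nat) = w" using w(2) c by (simp add: numeral_2_eq_2)
      finally have "x [^] (2::nat) \<preceq> y j \<otimes> w"
        using mle_trans[OF _ _ _ _ mle_add_right[of "y j" w]] c by simp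
      then show ?thesis
        unfolding stably_below_def using c
        by (intro exI[of _ 1]) (simp only: one_add_one multiple_one m_closed)
    next
      case (Suc l)
      then have "(y j \<otimes> w) [^] n = y j [^] n \<otimes> w"
        using idempotent_multiple[of w l] w(2) c by (simp only: nat_pow_distrib)
      then show ?thesis
        using \<open>x [^] (n + 1) \<preceq> y j [^] n \<otimes> w\<close> unfolding stably_below_def by metis
    qed
  qed
  then have "x \<preceq> finprod S (\<lambda>j. y j \<otimes> w) {0..m}"
    using m_comparisonD[OF assms x(1), of "\<lambda>j. y j \<otimes> w"] y(1) vw by blast
  then have "cls x \<preceq>\<^bsub>Q\<^esub> cls (finprod S (\<lambda>j. y j \<otimes> w) {0..m})"
    using cls_le_if_le x(1) y(1) vw by (simp add: Pi_def)
  also have "cls (finprod S (\<lambda>j. y j \<otimes> w) {0..m}) = finprod Q (\<lambda>j. cls (y j \<otimes> w)) {0..m}"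
    using cls_finprod[of "{0..m}" "\<lambda>j. y j \<otimes> w"] y(1) vw by (simp add: Pi_def)
  also have "\<dots> = finprod Q Y {0..m}"
  proof (rule comm_monoid.finprod_cong'[OF comm_monoid_quotient refl Y])
    fix j assume j: "j \<in> {0..m}"
    show "cls (y j \<otimes> w) = Y j" using cls_add_ideal[OF y(1)[OF j] w(1)] y(2)[OF j] by simp
  qed
  finally show "X \<preceq>\<^bsub>Q\<^esub> finprod Q Y {0..m}" using x(2) by simp
qed

lemma almost_divisible_quotient:
  assumes "almost_divisible n S"
  shows "almost_divisible n Q"
  unfolding almost_divisible_def
proof (intro allI ballI impI)
  fix k :: nat and X' X
  assume X: "X' \<in> carrier Q" "X \<in> carrier Q" "X' \<lless>\<^bsub>Q\<^esub> X"
  obtain x where x: "x \<in> carrier S" "X = cls x" using X by (auto simp: quotient_carrier)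
  obtain x' where x': "x' \<in> carrier S" "x' \<lless> x" "X' \<preceq>\<^bsub>Q\<^esub> cls x'"
    using way_below_quotient_lift[OF x(1)] X(3) x(2) by blast
  obtain y where y: "y \<in> carrier S" "y [^] k \<preceq> x" "x' \<preceq> y [^] ((k + 1) * (n + 1))"
    using assms x(1) x'(1,2) unfolding almost_divisible_def by blast
  have "cls y [^]\<^bsub>Q\<^esub> k \<preceq>\<^bsub>Q\<^esub> X"
    using cls_le_if_le[OF _ x(1) y(2)] y(1) x(2) by (simp add: cls_multiple)
  moreover have "X' \<preceq>\<^bsub>Q\<^esub> cls y [^]\<^bsub>Q\<^esub> ((k + 1) * (n + 1))"
    using quotient_le_trans[OF X(1) _ _ x'(3) cls_le_if_le[OF x'(1) _ y(3)]] x'(1) y(1)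
    by (simp only: cls_multiple cls_carrier nat_pow_closed)
  ultimately show "\<exists>Y\<in>carrier Q. Y [^]\<^bsub>Q\<^esub> k \<preceq>\<^bsub>Q\<^esub> X \<and> X' \<preceq>\<^bsub>Q\<^esub> Y [^]\<^bsub>Q\<^esub> ((k + 1) * (n + 1))"
    using cls_carrier[OF y(1)] by blast
qed

section \<open>Comparison in extensions\<close>

text \<open>
  An element of \<open>I\<close> below \<open>n y\<close> already lies, up to \<open>\<lless>\<close>, below \<open>n z\<close> for some part \<open>z\<close> of \<open>y\<close>
  that belongs to \<open>I\<close>: by (O6) it splits into \<open>n\<close> elements below \<open>y\<close>, which lie in \<open>I\<close> because \<open>I\<close> is
  hereditary, and by (O7) these have an approximate upper bound below \<open>y\<close> and below their sum.
\<close>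

lemma ideal_part_of_multiple:
  assumes O6: "cu_O6 S" and O7: "cu_O7 S" and y: "y \<in> carrier S"
    and "g \<in> I" "g' \<in> carrier S" "g' \<lless> g" "g \<preceq> y [^] (n::nat)"
  shows "\<exists>z\<in>I. z \<preceq> y \<and> g' \<preceq> z [^] n"
  using assms(4-)
proof (induction n arbitrary: g g')
  case 0
  then have "g' \<preceq> \<one>" using mle_trans[OF _ _ _ way_below_imp_le[OF _ 0(3)]] ideal_subset by simp
  then show ?case using ideal_zero mle_zero y by auto
next
  case (Suc n)
  note g = ideal_subset[OF Suc.prems(1)]
  obtain g1 where g1: "g1 \<in> carrier S" "g' \<lless> g1" "g1 \<lless> g"
    using way_below_interpolate[OF Suc.prems(2) g Suc.prems(3)] by blast
  obtain g2 where g2: "g2 \<in> carrier S" "g' \<lless> g2" "g2 \<lless> g1"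
    using way_below_interpolate[OF Suc.prems(2) g1(1,2)] by blast
  have "g \<preceq> y [^] n \<otimes> y" using Suc.prems(4) by simp
  then obtain e f where ef: "e \<in> carrier S" "f \<in> carrier S" "g1 \<preceq> e \<otimes> f"
    "e \<preceq> g" "e \<preceq> y [^] n" "f \<preceq> g" "f \<preceq> y"
    using O6[unfolded cu_O6_def] g1(1,3) g y nat_pow_closed[OF y] by metis
  have I: "e \<in> I" "f \<in> I" using ideal_hereditary Suc.prems(1) ef by blast+
  obtain f' where f': "f' \<in> carrier S" "f' \<lless> f" "g2 \<preceq> e \<otimes> f'"
    using way_below_shrink1[OF g2(1) g1(1) ef(1,2) g2(3) ef(3)] by blast
  have "g2 \<preceq> f' \<otimes> e" using f'(3) m_comm f'(1) ef(1) by simp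
  then obtain e' where e': "e' \<in> carrier S" "e' \<lless> e" "g' \<preceq> f' \<otimes> e'"
    using way_below_shrink1[OF Suc.prems(2) g2(1) f'(1) ef(1) g2(2)] by blast
  obtain e1 where e1: "e1 \<in> carrier S" "e' \<lless> e1" "e1 \<lless> e"
    using way_below_interpolate[OF e'(1) ef(1) e'(2)] by blast
  obtain z where z: "z \<in> I" "z \<preceq> y" "e1 \<preceq> z [^] n"
    using Suc.IH[OF I(1) e1(1,3) ef(5)] by blast
  note zc = ideal_subset[OF z(1)]
  obtain z' where z': "z' \<in> carrier S" "z' \<lless> z" "e' \<preceq> z' [^] n"
    using way_below_shrink[OF e'(1) e1(1) one_closed zc e1(2), of n] z(3) zc by auto
  obtain u where u: "u \<in> carrier S" "z' \<lless> u" "f' \<lless> u" "u \<preceq> y" "u \<preceq> z \<otimes> f"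
    using O7[unfolded cu_O7_def] z'(1,2) zc f'(1,2) ef(2,7) z(2) y by metis
  have "u \<in> I" using ideal_hereditary[OF u(1) ideal_add[OF z(1) I(2)] u(5)] .
  moreover have "g' \<preceq> u [^] Suc n"
  proof -
    have zu: "z' [^] n \<preceq> u [^] n"
      using multiple_mono way_below_imp_le u(1,2) z'(1) by simp
    have "e' \<preceq> u [^] n" using mle_trans[OF _ _ _ z'(3) zu] e'(1) z'(1) u(1) by simp
    then have "f' \<otimes> e' \<preceq> u \<otimes> u [^] n"
      using mle_add_mono way_below_imp_le[OF _ u(3)] e'(1) f'(1) u(1) by simp
    then have "f' \<otimes> e' \<preceq> u [^] Suc n" using u(1) by (simp add: m_comm)
    then show ?thesis using mle_trans[OF _ _ _ e'(3)] Suc.prems(2) e'(1) f'(1) u(1) by simp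
  qed
  ultimately show ?case using u(4) by blast
qed

text \<open>
  Comparison in the quotient bounds \<open>x\<close> by the first \<open>m\<^sub>2 + 1\<close> of the \<open>y\<^sub>j\<close> up to an error, which (O6)
  turns into an element \<open>f \<le> x\<close> of \<open>I\<close>. From \<open>(n + 1) f \<le> (n + 1) x \<le> n y\<^sub>j\<close> the preceding lemma
  finds \<open>z\<^sub>j \<le> y\<^sub>j\<close> in \<open>I\<close> with \<open>f <\<^sub>s z\<^sub>j\<close> up to \<open>\<lless>\<close>, and comparison in \<open>I\<close> bounds \<open>f\<close> by the
  remaining \<open>m\<^sub>1 + 1\<close> of the \<open>y\<^sub>j\<close>.
\<close>

lemma m_comparison_extension:
  assumes O6: "cu_O6 S" and O7: "cu_O7 S"
    and compI: "m_comparison m1 (cu_sub S I)" and compQ: "m_comparison m2 Q"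
  shows "m_comparison (m1 + m2 + 1) S"
  unfolding m_comparison_def
proof (intro ballI impI)
  let ?M = "m1 + m2 + 1" and ?h = "\<lambda>j. m2 + 1 + j"
  fix x y
  assume x: "x \<in> carrier S" and "y \<in> {0..?M} \<rightarrow> carrier S"
    and below: "\<forall>j\<in>{0..?M}. stably_below S x (y j)"
  then have y: "\<And>j. j \<in> {0..?M} \<Longrightarrow> y j \<in> carrier S" by auto
  let ?Y = "finprod S y {0..m2}" and ?Z = "finprod S (\<lambda>j. y (?h j)) {0..m1}"
  have Yc: "?Y \<in> carrier S" and Zc: "?Z \<in> carrier S" using y by (auto intro!: finprod_closed)
  have split: "finprod S y {0..?M} = ?Y \<otimes> ?Z"
  proof -
    have "{0..?M} = {0..m2} \<union> ?h ` {0..m1}"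
    proof (intro equalityI subsetI)
      fix j assume "j \<in> {0..?M}"
      then show "j \<in> {0..m2} \<union> ?h ` {0..m1}"
        by (cases "j \<le> m2") (auto intro!: image_eqI[of j _ "j - (m2 + 1)"])
    qed auto
    moreover have "finprod S y (?h ` {0..m1}) = ?Z"
      using y by (intro finprod_reindex) (auto simp: inj_on_def)
    moreover have "finprod S y ({0..m2} \<union> ?h ` {0..m1}) = ?Y \<otimes> finprod S y (?h ` {0..m1})"
      using y by (intro finprod_Un_disjoint) auto
    ultimately show ?thesis by simp
  qed
  have "stably_below Q (cls x) (cls (y j))" if j: "j \<in> {0..m2}" for j
  proof -
    have yj: "y j \<in> carrier S" and "stably_below S x (y j)" using y below j by auto
    then obtain n :: nat where "x [^] (n + 1) \<preceq> y j [^] n" unfolding stably_below_def by blast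
    then have "cls (x [^] (n + 1)) \<preceq>\<^bsub>Q\<^esub> cls (y j [^] n)"
      using cls_le_if_le[of "x [^] (n + 1)" "y j [^] n"] x yj by simp
    then show ?thesis
      unfolding stably_below_def cls_multiple[OF x] cls_multiple[OF yj] by blast
  qed
  then have "cls x \<preceq>\<^bsub>Q\<^esub> finprod Q (\<lambda>j. cls (y j)) {0..m2}"
    using y by (intro m_comparisonD[OF compQ cls_carrier[OF x]]) (simp_all add: cls_carrier)
  also have "finprod Q (\<lambda>j. cls (y j)) {0..m2} = cls ?Y"
    using y by (intro cls_finprod) auto
  finally obtain w where w: "w \<in> I" "x \<preceq> ?Y \<otimes> w" using cls_leE[OF x Yc] by blast
  note wc = ideal_subset[OF w(1)]
  have "x \<preceq> ?Y \<otimes> ?Z"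
  proof (rule le_if_way_below_le)
    fix x0 assume x0: "x0 \<in> carrier S" "x0 \<lless> x"
    obtain x1 where x1: "x1 \<in> carrier S" "x0 \<lless> x1" "x1 \<lless> x"
      using way_below_interpolate[OF x0(1) x x0(2)] by blast
    obtain e f where ef: "e \<in> carrier S" "f \<in> carrier S" "x1 \<preceq> e \<otimes> f" "e \<preceq> ?Y" "f \<preceq> x" "f \<preceq> w"
      using O6[unfolded cu_O6_def] x1(1,3) x Yc wc w(2) by metis
    have fI: "f \<in> I" using ideal_hereditary[OF ef(2) w(1) ef(6)] .
    obtain f' where f': "f' \<in> carrier S" "f' \<lless> f" "x0 \<preceq> e \<otimes> f'"
      using way_below_shrink1[OF x0(1) x1(1) ef(1,2) x1(2) ef(3)] by blast
    have f'I: "f' \<in> I" using ideal_hereditary[OF f'(1) fI way_below_imp_le[OF ef(2) f'(2)]] .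
    have "\<exists>z\<in>I. z \<preceq> y (?h j) \<and> stably_below S f' z" if j: "j \<in> {0..m1}" for j
    proof -
      have yj: "y (?h j) \<in> carrier S" and "stably_below S x (y (?h j))" using y below j by auto
      then obtain n :: nat where n: "x [^] (n + 1) \<preceq> y (?h j) [^] n"
        unfolding stably_below_def by blast
      have "f [^] (n + 1) \<preceq> y (?h j) [^] n"
        using mle_trans[OF _ _ _ multiple_mono[OF ef(2) x ef(5)] n] ef(2) x yj by simp
      then obtain z where "z \<in> I" "z \<preceq> y (?h j)" "f' [^] (n + 1) \<preceq> z [^] n"
        using ideal_part_of_multiple[OF O6 O7 yj ideal_multiple[OF fI] _
            way_below_multiple[OF f'(1) ef(2) f'(2)], of "n + 1" n] f'(1) by auto
      then show ?thesis unfolding stably_below_def by blast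
    qed
    then obtain z where z: "\<And>j. j \<in> {0..m1} \<Longrightarrow> z j \<in> I"
      "\<And>j. j \<in> {0..m1} \<Longrightarrow> z j \<preceq> y (?h j)"
      "\<And>j. j \<in> {0..m1} \<Longrightarrow> stably_below S f' (z j)" by metis
    have zI: "z \<in> {0..m1} \<rightarrow> I" using z(1) by blast
    have "f' \<preceq> finprod (cu_sub S I) z {0..m1}"
      using m_comparisonD[OF compI, of f' z] f'I z(1,3)
      unfolding stably_below_def sub_multiple sub_simps by blast
    then have f'z: "f' \<preceq> finprod S z {0..m1}" using sub_finprod[OF _ zI] by simp
    have zc: "z \<in> {0..m1} \<rightarrow> carrier S" using z(1) ideal_subset by blast
    have zZ: "finprod S z {0..m1} \<preceq> ?Z" using zc y z(2) by (intro finprod_mono) auto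
    have "f' \<preceq> ?Z" using mle_trans[OF f'(1) finprod_closed[OF zc] Zc f'z zZ] .
    then have "e \<otimes> f' \<preceq> ?Y \<otimes> ?Z" using mle_add_mono ef(1,4) f'(1) Yc Zc by simp
    then show "x0 \<preceq> ?Y \<otimes> ?Z"
      using mle_trans[OF _ _ _ f'(3)] x0(1) ef(1) f'(1) Yc Zc by simp
  qed (use x Yc Zc in simp_all)
  then show "x \<preceq> finprod S y {0..?M}" using split by simp
qed

section \<open>Divisibility in extensions\<close>

text \<open>
  Division by \<open>k\<close> modulo \<open>w\<close> lifts. For one more summand, (O8) finds \<open>z\<^sub>1 + z\<^sub>2\<close> below \<open>x\<close>, where
  \<open>z\<^sub>1\<close> is to be divided by \<open>k\<close> and \<open>z\<^sub>2\<close> dominates \<open>y\<close> modulo \<open>w\<close>. The two resulting lifts of \<open>y\<close> differ, but (O6)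
  applied twice finds a common lower bound of them that still dominates \<open>y\<close> modulo \<open>w\<close>,
  up to \<open>\<lless>\<close>.
\<close>

lemma lift_division:
  assumes O6: "cu_O6 S" and O8: "cu_O8 S" and w: "w \<in> carrier S" "w \<otimes> w = w"
    and "x \<in> carrier S" "y \<in> carrier S" "y' \<in> carrier S" "y' \<lless> y" "y [^] (k::nat) \<preceq> x \<otimes> w"
  shows "\<exists>z\<in>carrier S. z [^] k \<preceq> x \<and> y' \<preceq> z \<otimes> w"
  using assms(5-)
proof (induction k arbitrary: x y y')
  case 0
  have "y' \<preceq> y \<otimes> w"
    using mle_trans[OF _ _ _ way_below_imp_le[OF _ 0(4)] mle_add_left] 0 w(1) by simp
  then show ?case using 0 mle_zero by auto
next
  case (Suc k)
  note c = Suc.prems(1-3)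
  obtain y4 where y4: "y4 \<in> carrier S" "y' \<lless> y4" "y4 \<lless> y"
    using way_below_interpolate[OF c(3,2) Suc.prems(4)] by blast
  obtain y3 where y3: "y3 \<in> carrier S" "y' \<lless> y3" "y3 \<lless> y4"
    using way_below_interpolate[OF c(3) y4(1,2)] by blast
  obtain y2 where y2: "y2 \<in> carrier S" "y' \<lless> y2" "y2 \<lless> y3"
    using way_below_interpolate[OF c(3) y3(1,2)] by blast
  obtain y1 where y1: "y1 \<in> carrier S" "y' \<lless> y1" "y1 \<lless> y2"
    using way_below_interpolate[OF c(3) y2(1,2)] by blast
  have "y4 [^] k \<otimes> y4 \<lless> y [^] Suc k"
    using way_below_multiple[OF y4(1) c(2) y4(3), of "Suc k"] by simp
  then have big: "y4 [^] k \<otimes> y4 \<lless> x \<otimes> w"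
    using way_below_mono[OF _ _ _ _ mle_refl _ Suc.prems(5)] y4(1) c w(1) by simp
  have "w [^] (2::nat) = w" using w by (simp add: numeral_2_eq_2)
  then obtain z1 z2 where z: "z1 \<in> carrier S" "z2 \<in> carrier S" "z1 \<otimes> z2 \<lless> x"
    "y3 [^] k \<lless> z1 \<otimes> w" "y3 \<lless> z2 \<otimes> w"
    using O8[unfolded cu_O8_def, rule_format, of "y3 [^] k" "y4 [^] k" y3 y4 x w]
      big way_below_multiple[OF y3(1) y4(1) y3(3), of k] y3 y4(1) c w(1) by auto
  have "y3 [^] k \<preceq> z1 \<otimes> w" using way_below_imp_le z w(1) by simp
  then obtain v where v: "v \<in> carrier S" "v [^] k \<preceq> z1" "y2 \<preceq> v \<otimes> w"
    using Suc.IH[OF z(1) y3(1) y2(1,3)] by blast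
  obtain e f where ef: "e \<in> carrier S" "f \<in> carrier S" "y1 \<preceq> e \<otimes> f" "e \<preceq> y2" "e \<preceq> v" "f \<preceq> w"
    using O6[unfolded cu_O6_def] y1(1,3) y2(1) v(1,3) w(1) by metis
  have "y1 \<preceq> w \<otimes> e"
  proof -
    have "e \<otimes> f \<preceq> e \<otimes> w" using mle_add_mono mle_refl ef w(1) by simp
    then show ?thesis using mle_trans[OF _ _ _ ef(3)] y1(1) ef w(1) by (simp add: m_comm)
  qed
  then obtain e' where e': "e' \<in> carrier S" "e' \<lless> e" "y' \<preceq> w \<otimes> e'"
    using way_below_shrink1[OF c(3) y1(1) w(1) ef(1) y1(2)] by blast
  have "e \<preceq> z2 \<otimes> w"
  proof -
    have "e \<preceq> y3" using mle_trans[OF _ _ _ ef(4) way_below_imp_le[OF _ y2(3)]] ef y2 y3 by simp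
    moreover have "y3 \<preceq> z2 \<otimes> w" using way_below_imp_le z w(1) by simp
    ultimately show ?thesis using mle_trans[of e y3 "z2 \<otimes> w"] ef y3 z w(1) by simp
  qed
  then obtain s t where st: "s \<in> carrier S" "t \<in> carrier S" "e' \<preceq> s \<otimes> t" "s \<preceq> e" "s \<preceq> z2" "t \<preceq> w"
    using O6[unfolded cu_O6_def] e'(1,2) ef(1) z(2) w(1) by metis
  have "s \<preceq> v" using mle_trans[OF _ _ _ st(4) ef(5)] st ef v by simp
  then have "s [^] k \<preceq> z1" using mle_trans[OF _ _ _ multiple_mono v(2)] st v z by simp
  then have "s [^] Suc k \<preceq> z1 \<otimes> z2" using mle_add_mono st z by simp
  then have "s [^] Suc k \<preceq> x"
    using mle_trans[OF _ _ _ _ way_below_imp_le[OF _ z(3)]] st(1) z c by simp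
  moreover have "y' \<preceq> s \<otimes> w"
  proof -
    have "s \<otimes> t \<preceq> s \<otimes> w" using mle_add_mono mle_refl st w(1) by simp
    then have "e' \<preceq> s \<otimes> w" using mle_trans[OF _ _ _ st(3)] e' st w(1) by simp
    then have "w \<otimes> e' \<preceq> w \<otimes> (s \<otimes> w)" using mle_add_mono mle_refl e' st w(1) by simp
    also have "w \<otimes> (s \<otimes> w) = s \<otimes> (w \<otimes> w)" using st(1) w(1) by (simp add: m_ac)
    finally show ?thesis using mle_trans[OF _ _ _ e'(3)] c e' st w by simp
  qed
  ultimately show ?case using st(1) by blast
qed

text \<open>
  The element \<open>z\<^sub>0 + q\<close> works. It takes \<open>(2 k + 1) (n\<^sub>2 + 1)\<close> copies of \<open>z\<^sub>0\<close> to dominate \<open>x'\<close>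
  modulo \<open>I\<close>, and \<open>2 (k + 1) (n\<^sub>1 + 1)\<close> copies of \<open>q\<close> for the remainder, as it is bounded by \<open>2 f\<^sub>0\<close>;
  the constant \<open>2 (n\<^sub>1 + n\<^sub>2 + 1)\<close> covers both numbers for every \<open>k\<close>.
\<close>

lemma almost_divisible_extension:
  assumes O5: "cu_O5 S" and O6: "cu_O6 S" and O7: "cu_O7 S" and O8: "cu_O8 S"
    and divI: "almost_divisible n1 (cu_sub S I)" and divQ: "almost_divisible n2 Q"
  shows "almost_divisible (2 * (n1 + n2 + 1)) S"
  unfolding almost_divisible_def
proof (intro allI ballI impI)
  fix k :: nat and x' x
  assume x: "x \<in> carrier S" and x': "x' \<in> carrier S" "x' \<lless> x"
  let ?C = "(2 * k + 1) * (n2 + 1)" and ?E = "(k + 1) * (n1 + 1)"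
    and ?D = "(k + 1) * (2 * (n1 + n2 + 1) + 1)"
  obtain x6 where x6: "x6 \<in> carrier S" "x' \<lless> x6" "x6 \<lless> x"
    using way_below_interpolate[OF x'(1) x x'(2)] by blast
  obtain x5 where x5: "x5 \<in> carrier S" "x' \<lless> x5" "x5 \<lless> x6"
    using way_below_interpolate[OF x'(1) x6(1,2)] by blast
  obtain x4 where x4: "x4 \<in> carrier S" "x' \<lless> x4" "x4 \<lless> x5"
    using way_below_interpolate[OF x'(1) x5(1,2)] by blast
  obtain x3 where x3: "x3 \<in> carrier S" "x' \<lless> x3" "x3 \<lless> x4"
    using way_below_interpolate[OF x'(1) x4(1,2)] by blast
  obtain x2 where x2: "x2 \<in> carrier S" "x' \<lless> x2" "x2 \<lless> x3"
    using way_below_interpolate[OF x'(1) x3(1,2)] by blast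
  obtain x1 where x1: "x1 \<in> carrier S" "x' \<lless> x1" "x1 \<lless> x2"
    using way_below_interpolate[OF x'(1) x2(1,2)] by blast

  \<comment> \<open>Divide by \<open>2 k\<close> modulo \<open>I\<close>, and lift the result.\<close>
  obtain Y where "Y \<in> carrier Q" "Y [^]\<^bsub>Q\<^esub> (2 * k) \<preceq>\<^bsub>Q\<^esub> cls x" "cls x6 \<preceq>\<^bsub>Q\<^esub> Y [^]\<^bsub>Q\<^esub> ?C"
    using divQ way_below_quotient[OF x6(1) x x6(3)] cls_carrier x x6(1)
    unfolding almost_divisible_def by blast
  then obtain y where y: "y \<in> carrier S" "cls (y [^] (2 * k)) \<preceq>\<^bsub>Q\<^esub> cls x" "cls x6 \<preceq>\<^bsub>Q\<^esub> cls (y [^] ?C)"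
    unfolding quotient_carrier by (elim imageE) (simp only: cls_multiple)
  obtain w1 where w1: "w1 \<in> I" "y [^] (2 * k) \<preceq> x \<otimes> w1"
    by (rule cls_leE[OF nat_pow_closed[OF y(1)] x y(2)])
  obtain w2 where w2: "w2 \<in> I" "x6 \<preceq> y [^] ?C \<otimes> w2"
    by (rule cls_leE[OF x6(1) nat_pow_closed[OF y(1)] y(3)])
  obtain w where w: "w \<in> I" "w \<otimes> w = w" "w1 \<preceq> w" "w2 \<preceq> w"
    using ideal_absorbing_bound2[OF w1(1) w2(1)] by blast
  note wc = ideal_subset[OF w(1)] ideal_subset[OF w1(1)] ideal_subset[OF w2(1)]
  have yx: "y [^] (2 * k) \<preceq> x \<otimes> w"
    using mle_trans[OF _ _ _ w1(2) mle_add_mono[OF _ _ _ _ mle_refl w(3)]] x y(1) wc by simp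
  have "x6 \<preceq> y [^] ?C \<otimes> w"
    using mle_trans[OF _ _ _ w2(2) mle_add_mono[OF _ _ _ _ mle_refl w(4)]] x6(1) y(1) wc by simp
  then have "x6 \<preceq> w \<otimes> y [^] ?C" using y(1) wc by (simp add: m_comm)
  then obtain y' where y': "y' \<in> carrier S" "y' \<lless> y" "x5 \<preceq> w \<otimes> y' [^] ?C"
    using way_below_shrink[OF x5(1) x6(1) wc(1) y(1) x5(3)] by blast
  obtain z where z: "z \<in> carrier S" "z [^] (2 * k) \<preceq> x" "y' \<preceq> z \<otimes> w"
    using lift_division[OF O6 O8 wc(1) w(2) x y(1) y'(1,2) yx] by blast
  have "x5 \<preceq> w \<otimes> z [^] ?C"
  proof -
    have "y' [^] ?C \<preceq> z [^] ?C \<otimes> w [^] ?C"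
      using multiple_mono[OF y'(1) _ z(3), of ?C] z(1) wc by (simp only: nat_pow_distrib m_closed)
    moreover have "z [^] ?C \<otimes> w [^] ?C \<preceq> z [^] ?C \<otimes> w"
      using mle_add_mono mle_refl multiple_le_idempotent[OF wc(1) w(2)] z(1) wc
      by (simp only: nat_pow_closed)
    ultimately have "y' [^] ?C \<preceq> z [^] ?C \<otimes> w"
      using mle_trans[of "y' [^] ?C" "z [^] ?C \<otimes> w [^] ?C" "z [^] ?C \<otimes> w"] y'(1) z(1) wc
      by (simp only: nat_pow_closed m_closed)
    then have "w \<otimes> y' [^] ?C \<preceq> w \<otimes> (z [^] ?C \<otimes> w)"
      using mle_add_mono mle_refl y'(1) z(1) wc by (simp only: nat_pow_closed m_closed)
    also have "w \<otimes> (z [^] ?C \<otimes> w) = w \<otimes> w \<otimes> z [^] ?C"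
      using m_ac wc z(1) nat_pow_closed by metis
    also have "\<dots> = w \<otimes> z [^] ?C" using w(2) by (simp only:)
    finally show ?thesis
      using mle_trans[OF x5(1) _ _ y'(3)] wc y'(1) z(1) by (simp only: nat_pow_closed m_closed)
  qed
  then obtain z0 where z0: "z0 \<in> carrier S" "z0 \<lless> z" "x4 \<preceq> w \<otimes> z0 [^] ?C"
    using way_below_shrink[OF x4(1) x5(1) wc(1) z(1) x4(3)] by blast
  obtain z1 where z1: "z1 \<in> carrier S" "z0 \<lless> z1" "z1 \<lless> z"
    using way_below_interpolate[OF z0(1) z(1) z0(2)] by blast
  note pc = nat_pow_closed[OF z0(1)] nat_pow_closed[OF z1(1)] nat_pow_closed[OF z(1)]

  \<comment> \<open>The second half of \<open>2 k z \<le> x\<close> keeps a copy of \<open>k z\<^sub>1\<close> inside the complement \<open>u\<close> of \<open>k z\<^sub>0\<close>. Hence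
    \<open>k z\<^sub>0 + u \<le> x\<close> and yet \<open>x \<le> 2 u\<close>.\<close>
  have "z1 [^] k \<otimes> z [^] k \<preceq> z [^] k \<otimes> z [^] k"
    using mle_add_mono mle_refl multiple_mono way_below_imp_le z1 z(1) by simp
  also have "z [^] k \<otimes> z [^] k = z [^] (2 * k)" using z(1) by (simp add: nat_pow_mult mult_2)
  finally have "z1 [^] k \<otimes> z [^] k \<preceq> x" using mle_trans[OF _ _ _ _ z(2)] z(1) z1(1) x by simp
  then obtain u where u: "u \<in> carrier S" "z0 [^] k \<otimes> u \<preceq> x" "x \<preceq> z1 [^] k \<otimes> u" "z1 [^] k \<lless> u"
    using O5[unfolded cu_O5_def] way_below_multiple[OF z0(1) z1(1,2), of k]
      way_below_multiple[OF z1(1) z(1) z1(3), of k] pc x by metis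
  have xu: "x \<preceq> u [^] (2::nat)"
  proof -
    have "z1 [^] k \<otimes> u \<preceq> u \<otimes> u"
      using mle_add_mono mle_refl way_below_imp_le u(1,4) z1(1) by simp
    then have "x \<preceq> u \<otimes> u" using mle_trans[OF _ _ _ u(3)] x z1(1) u(1) by simp
    then show ?thesis using u(1) by (simp add: numeral_2_eq_2)
  qed

  \<comment> \<open>Thus the part of \<open>x\<close> missed by \<open>z\<^sub>0\<close> comes from a part \<open>f\<^sub>0\<close> of \<open>u\<close> in \<open>I\<close>, which is divided inside \<open>I\<close>.\<close>
  have "x4 \<preceq> z0 [^] ?C \<otimes> w" using z0(3) m_comm wc(1) pc(1) by metis
  then obtain e f where ef: "e \<in> carrier S" "f \<in> carrier S" "x3 \<preceq> e \<otimes> f" "e \<preceq> z0 [^] ?C" "f \<preceq> x4" "f \<preceq> w"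
    using O6[unfolded cu_O6_def] x3(1,3) x4(1) wc(1) pc(1) by metis
  have fI: "f \<in> I" using ideal_hereditary[OF ef(2) w(1) ef(6)] .
  obtain f' where f': "f' \<in> carrier S" "f' \<lless> f" "x2 \<preceq> e \<otimes> f'"
    using way_below_shrink1[OF x2(1) x3(1) ef(1,2) x2(3) ef(3)] by blast
  have "f \<preceq> u [^] (2::nat)"
  proof -
    have "x4 \<lless> x6"
      using way_below_mono[OF _ _ _ _ _ x4(3)] way_below_imp_le x4(1) x5 x6(1) mle_refl by simp
    then have "f \<preceq> x6" using mle_trans[OF _ _ _ ef(5)] way_below_imp_le ef(2) x4(1) x6(1) by simp
    then have "f \<preceq> x" using mle_trans[OF _ _ _ _ way_below_imp_le[OF x x6(3)]] ef(2) x6(1) x by simp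
    then show ?thesis using mle_trans[OF _ _ _ _ xu] ef(2) x u(1) by simp
  qed
  then obtain f0 where f0: "f0 \<in> I" "f0 \<preceq> u" "f' \<preceq> f0 [^] (2::nat)"
    using ideal_part_of_multiple[OF O6 O7 u(1) fI f'(1,2)] by blast
  note f0c = ideal_subset[OF f0(1)]
  have "x2 \<preceq> e \<otimes> f0 [^] (2::nat)"
    using mle_trans[OF _ _ _ f'(3) mle_add_mono[OF _ _ _ _ mle_refl f0(3)]] x2(1) ef(1) f'(1) f0c by simp
  then obtain f1 where f1: "f1 \<in> carrier S" "f1 \<lless> f0" "x1 \<preceq> e \<otimes> f1 [^] (2::nat)"
    using way_below_shrink[OF x1(1) x2(1) ef(1) f0c x1(3)] by blast
  have f1I: "f1 \<in> I" using ideal_hereditary[OF f1(1) f0(1)] way_below_imp_le[OF f0c f1(2)] by blast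
  obtain q where q: "q \<in> I" "q [^] k \<preceq> f0" "f1 \<preceq> q [^] ?E"
    using divI f1I f0(1) f1(2) unfolding almost_divisible_def sub_multiple sub_simps
    by (metis sub_way_below)
  note qc = ideal_subset[OF q(1)] and c = z0(1) ideal_subset[OF q(1)]
  have "(z0 \<otimes> q) [^] k \<preceq> x"
  proof -
    have "q [^] k \<preceq> u" using mle_trans[OF _ _ _ q(2) f0(2)] qc f0c u(1) by simp
    then have "z0 [^] k \<otimes> q [^] k \<preceq> z0 [^] k \<otimes> u" using mle_add_mono mle_refl c u(1) by simp
    then have "z0 [^] k \<otimes> q [^] k \<preceq> x" using mle_trans[OF _ _ _ _ u(2)] c u(1) x by simp
    then show ?thesis using c by (simp add: nat_pow_distrib)
  qed
  moreover have "x' \<preceq> (z0 \<otimes> q) [^] ?D"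
  proof -
    have "?C \<le> ?D" "?E * 2 \<le> ?D" by (simp_all add: algebra_simps)
    then have mult: "z0 [^] ?C \<preceq> z0 [^] ?D" "q [^] (?E * 2) \<preceq> q [^] ?D"
      using multiple_le_multiple c by blast+
    have e: "e \<preceq> z0 [^] ?D" using mle_trans[OF ef(1) pc(1) pc(1) ef(4) mult(1)] .
    have "f1 [^] (2::nat) \<preceq> (q [^] ?E) [^] (2::nat)"
      using multiple_mono[OF f1(1) nat_pow_closed[OF qc] q(3)] .
    also have "(q [^] ?E) [^] (2::nat) = q [^] (?E * 2)" using nat_pow_pow[OF qc] .
    finally have "f1 [^] (2::nat) \<preceq> q [^] ?D"
      using mle_trans[OF nat_pow_closed[OF f1(1)] nat_pow_closed[OF qc] nat_pow_closed[OF qc] _ mult(2)]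
      by blast
    then have "e \<otimes> f1 [^] (2::nat) \<preceq> z0 [^] ?D \<otimes> q [^] ?D"
      using mle_add_mono[OF ef(1) pc(1) nat_pow_closed[OF f1(1)] nat_pow_closed[OF qc] e] by blast
    also have "z0 [^] ?D \<otimes> q [^] ?D = (z0 \<otimes> q) [^] ?D" using nat_pow_distrib[OF c] by (rule sym)
    finally have "x1 \<preceq> (z0 \<otimes> q) [^] ?D"
      using mle_trans[OF x1(1) _ _ f1(3)] ef(1) f1(1) c by (simp only: nat_pow_closed m_closed)
    then show ?thesis
      using mle_trans[OF x'(1) x1(1) _ way_below_imp_le[OF x1(1,2)]] c
      by (simp only: nat_pow_closed m_closed)
  qed
  ultimately show "\<exists>v\<in>carrier S. v [^] k \<preceq> x \<and> x' \<preceq> v [^] ((k + 1) * (2 * (n1 + n2 + 1) + 1))"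
    using c by blast
qed

end

theorem theorem4p10:
  fixes S :: "('a, 'b) ordered_monoid_scheme" and I :: "'a set"
  assumes "cu_semigroup S"
    and "cu_O5 S" and "cu_O6 S" and "cu_O7 S" and "cu_O8 S"
    and "cu_ideal I S"
  shows "(\<exists>m n. pure m n S) \<longleftrightarrow>
    (\<exists>m' n'. pure m' n' (cu_sub S I)) \<and> (\<exists>m'' n''. pure m'' n'' (cu_quotient S I))"
proof -
  interpret cu_semigroup_ideal S I
    using assms(1,6) by (simp add: cu_semigroup_ideal_def cu_semigroup_ideal_axioms_def)
  show ?thesis
    unfolding pure_def
    using m_comparison_ideal almost_divisible_ideal m_comparison_quotient almost_divisible_quotient
      m_comparison_extension[OF assms(3,4)] almost_divisible_extension[OF assms(2-5)]
    by blast
qed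

end
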